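(* Let $0\le\alpha<\omega_1$ and let $K$ be a compact Hausdorff space whose Cantor–Bendixson derived sets satisfy $K^{(\omega^\alpha)}\neq\emptyset$ and $K^{(\omega^{\alpha+1})}=\emptyset$. Then $\mathrm{Dz}(C(K))=\omega^{1+\alpha+1}$.
   Context: Derived sets: $K^{(0)}=K$, $K^{(\beta+1)}$ is the set of accumulation points of $K^{(\beta)}$, $K^{(\beta)}=\bigcap_{\mu<\beta}K^{(\mu)}$ for limit $\beta$. $C(K)$ is the sup-normed space of real continuous functions on $K$. For a real Banach space $X$: $H(x,t)=\{x^*\in X^*: x^*(x)>t\}$; a weak$^*$-slice of a weak$^*$-compact $L\subset X^*$ is a nonempty $H(x,t)\cap L$; $d_\varepsilon L$ is $L$ minus the union of all weak$^*$-slices of $L$ of norm diameter $<\varepsilon$; $d_\varepsilon^0L=L$, $d_\varepsilon^{\beta+1}L=d_\varepsilon(d_\varepsilon^\beta L)$, $d_\varepsilon^\beta L=\bigcap_{\mu<\beta}d_\varepsilon^\mu L$ for limit $\beta$. $\mathrm{Dz}(X,\varepsilon)$ is the least ordinal $\beta$ with $d_\varepsilon^\beta B_{X^*}=\emptyset$ (or $\infty$), and $\mathrm{Dz}(X)=\sup_{\varepsilon>0}\mathrm{Dz}(X,\varepsilon)$. Ordinal arithmetic throughout. *)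

theory Defs
  imports "HOL-Analysis.Analysis"
begin

text \<open>Ordinals are represented by well-order relations (as in the HOL BNF/cardinal library;
  they are compared with ordLess, i.e. up to isomorphism).  For a well-order r,
  titer r f X0 is the (ordertype r)-th iterate of f starting at X0:
  index 0 gives X0, a successor index applies f to the previous stage,
  a limit index takes the intersection of all previous stages.\<close>

definition tstep :: "('s set \<Rightarrow> 's set) \<Rightarrow> 's set \<Rightarrow> 'i rel \<Rightarrow> 'i set \<Rightarrow> ('i \<Rightarrow> 's set) \<Rightarrow> 's set"
  where "tstep f X0 r S g =
     (if S = {} then X0
      else if (\<exists>m\<in>S. \<forall>b\<in>S. (b, m) \<in> r)
        then f (g (THE m. m \<in> S \<and> (\<forall>b\<in>S. (b, m) \<in> r)))
      else (\<Inter>b\<in>S. g b))"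

text \<open>value at the element a of Field r = iterate indexed by the ordertype of the strict
  initial segment below a\<close>
definition titer_at :: "'i rel \<Rightarrow> ('s set \<Rightarrow> 's set) \<Rightarrow> 's set \<Rightarrow> 'i \<Rightarrow> 's set"
  where "titer_at r f X0 = wfrec (r - Id) (\<lambda>g a. tstep f X0 r (underS r a) g)"

definition titer :: "'i rel \<Rightarrow> ('s set \<Rightarrow> 's set) \<Rightarrow> 's set \<Rightarrow> 's set"
  where "titer r f X0 = tstep f X0 r (Field r) (titer_at r f X0)"

definition osucc :: "'a rel \<Rightarrow> ('a option) rel"
  where "osucc r = {(Some x, Some y) | x y. (x, y) \<in> r}
                 \<union> {(Some x, None) | x. x \<in> Field r} \<union> {(None, None)}"

definition oneplus :: "'a rel \<Rightarrow> ('a option) rel"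
  where "oneplus r = {(Some x, Some y) | x y. (x, y) \<in> r}
                 \<union> {(None, Some x) | x. x \<in> Field r} \<union> {(None, None)}"

text \<open>omega ^ alpha: finitely supported functions Field alpha \<rightarrow> nat (0 outside Field alpha),
  ordered by comparing the values at the alpha-largest argument where they differ
  (the standard construction of ordinal exponentiation, base omega).\<close>
definition omega_exp :: "'a rel \<Rightarrow> ('a \<Rightarrow> nat) rel"
  where "omega_exp r =
    {(f, g). finite {x. f x \<noteq> 0} \<and> finite {x. g x \<noteq> 0}
       \<and> {x. f x \<noteq> 0} \<subseteq> Field r \<and> {x. g x \<noteq> 0} \<subseteq> Field r
       \<and> (f = g \<or> (\<exists>x\<in>Field r. f x < g x \<and> (\<forall>y\<in>Field r. (x, y) \<in> r \<and> y \<noteq> x \<longrightarrow> f y = g y)))}"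

definition derived_set :: "'a::topological_space set \<Rightarrow> 'a set"
  where "derived_set S = {x. x islimpt S}"

definition wslice :: "'x::real_normed_vector \<Rightarrow> real \<Rightarrow> ('x \<Rightarrow>\<^sub>L real) set \<Rightarrow> ('x \<Rightarrow>\<^sub>L real) set"
  where "wslice x t L = {\<phi> \<in> L. blinfun_apply \<phi> x > t}"

definition dz_deriv :: "real \<Rightarrow> ('x::real_normed_vector \<Rightarrow>\<^sub>L real) set \<Rightarrow> ('x \<Rightarrow>\<^sub>L real) set"
  where "dz_deriv \<epsilon> L = L - \<Union>{wslice x t L | x t. wslice x t L \<noteq> {} \<and> diameter (wslice x t L) < \<epsilon>}"

definition dual_ball :: "('x::real_normed_vector \<Rightarrow>\<^sub>L real) set"
  where "dual_ball = {\<phi>. norm \<phi> \<le> 1}"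

text \<open>Dz(X) = gamma, where Dz(X) = sup over eps>0 of Dz(X,eps) and Dz(X,eps) is the least
  beta with d_eps^beta(B_X*) empty (or infinity).  Since the iterates decrease,
  Dz(X,eps) \<le> gamma iff d_eps^gamma B = {} and Dz(X,eps) > beta iff d_eps^beta B \<noteq> {};
  hence sup = gamma iff the two conditions below hold (ordinals below gamma are represented
  by well-orders on the same carrier type as gamma).\<close>
definition Dz_eq :: "'x::real_normed_vector itself \<Rightarrow> 'i rel \<Rightarrow> bool"
  where "Dz_eq _ \<gamma> \<longleftrightarrow>
     (\<forall>\<epsilon>>0. titer \<gamma> (dz_deriv \<epsilon>) (dual_ball :: ('x \<Rightarrow>\<^sub>L real) set) = {}) \<and>
     (\<forall>\<beta>::'i rel. Well_order \<beta> \<and> (\<beta>, \<gamma>) \<in> ordLess \<longrightarrow>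
        (\<exists>\<epsilon>>0. titer \<beta> (dz_deriv \<epsilon>) (dual_ball :: ('x \<Rightarrow>\<^sub>L real) set) \<noteq> {}))"

end

theory Submission
  imports Defs
begin

text \<open>
  Lower bound: if \<open>\<psi> + c \<delta>\<^sub>y\<close> lies in a convex weak* closed \<open>L\<close> for all \<open>y\<close> in \<open>C\<close> and \<open>z\<close> is a limit
  point of \<open>C\<close>, then \<open>\<psi> + c \<delta>\<^sub>z\<close> is a weak* limit of averages of \<open>2\<^sup>k\<close> such points, which survive
  \<open>k\<close> derivations. So one Cantor-Bendixson derivation is worth \<open>\<omega>\<close> dentability derivations. Applied to
  a point of the derived set of order \<open>\<omega>\<^sup>\<alpha>\<close> and to both signs of \<open>c\<close>, this shows that \<open>\<omega>\<^sup>1\<^sup>+\<^sup>\<alpha>\<close>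
  derivations shrink the radius of a contained ball by at most \<open>|c|\<close>.

  Upper bound: by induction on \<open>\<alpha>\<close>, a set of functionals whose mass is, up to a small error, concentrated
  on finitely many blocks \<open>C - C'\<close>, with \<open>C'\<close> the derived set of \<open>C\<close> of order \<open>\<omega>\<^sup>\<alpha>\<close>, vanishes after
  \<open>\<omega>\<^sup>1\<^sup>+\<^sup>\<alpha> k\<close> derivations. The sum \<open>H \<psi>\<close> of the masses \<open>|\<psi>|(K - C')\<close> is a bounded, convex and
  weak* lower semicontinuous potential. A functional \<open>\<phi>\<close> with \<open>H \<phi>\<close> nearly maximal is norming for functions
  \<open>g\<^sub>C\<close> supported in \<open>K - C'\<close>, and all functionals in the slice given by \<open>\<Sum> g\<^sub>C\<close> have most of their mass in
  \<open>K - C'\<close> on the support of \<open>g\<^sub>C\<close>. By compactness this support avoids already a derived set of \<open>C\<close>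
  of order \<open>\<omega>\<^sup>\<beta> m\<close> with \<open>\<beta> < \<alpha>\<close>, so the block splits into \<open>m\<close> blocks of order \<open>\<omega>\<^sup>\<beta>\<close> and the
  induction hypothesis removes \<open>\<phi>\<close>. Hence \<open>\<omega>\<^sup>1\<^sup>+\<^sup>\<alpha>\<close> derivations lower the supremum of the potential by a
  fixed amount. To stay inside a given slice, a large multiple of the slicing functional is added to the potential;
  this avoids comparing the derivations of a slice with those of the whole set.
\<close>

section \<open>Transfinite iteration\<close>

lemma tstep_max:
  assumes "antisym r" "m \<in> S" "\<And>b. b \<in> S \<Longrightarrow> (b, m) \<in> r"
  shows "tstep f X r S g = f (g m)"
proof -
  have "(THE m. m \<in> S \<and> (\<forall>b\<in>S. (b, m) \<in> r)) = m"
    using assms by (intro the_equality) (auto dest: antisymD)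
  then show ?thesis
    using assms by (auto simp: tstep_def)
qed

lemma tstep_limit:
  assumes "S \<noteq> {}" "\<And>m. m \<in> S \<Longrightarrow> \<exists>b\<in>S. (b, m) \<notin> r"
  shows "tstep f X r S g = (\<Inter>b\<in>S. g b)"
  using assms by (auto simp: tstep_def)

lemma tstep_cong:
  assumes "antisym r" "\<And>b. b \<in> S \<Longrightarrow> g b = h b"
  shows "tstep f X r S g = tstep f X r S h"
proof (cases "S \<noteq> {} \<and> (\<exists>m\<in>S. \<forall>b\<in>S. (b, m) \<in> r)")
  case True
  then obtain m where m: "m \<in> S" "\<And>b. b \<in> S \<Longrightarrow> (b, m) \<in> r" by blast
  show ?thesis
    using tstep_max[OF assms(1) m] assms(2)[OF m(1)] by metis
next
  case False
  then show ?thesis using assms(2) by (auto simp: tstep_def)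
qed

text \<open>\<open>tstep\<close> reads its function argument only on the index set, so the
  \<open>cut\<close> inserted by \<open>wfrec\<close> is harmless.\<close>

lemma titer_at_unfold:
  assumes "wf (r - Id)" "antisym r"
  shows "titer_at r f X a = tstep f X r (underS r a) (titer_at r f X)"
proof -
  have "titer_at r f X a =
      tstep f X r (underS r a) (cut (wfrec (r - Id) (\<lambda>g a. tstep f X r (underS r a) g)) (r - Id) a)"
    unfolding titer_at_def by (subst wfrec[OF assms(1)]) simp
  also have "\<dots> = tstep f X r (underS r a) (titer_at r f X)"
    by (rule tstep_cong[OF assms(2)]) (auto simp: cut_def underS_def titer_at_def)
  finally show ?thesis .
qed

text \<open>\<open>f\<close> is an operation that shrinks the sets of a class \<open>P\<close> closed under
  \<open>f\<close> and intersections; this makes the iteration decreasing even though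
  \<^const>\<open>derived_set\<close> only shrinks closed sets.\<close>

definition shrinking :: "('s set \<Rightarrow> bool) \<Rightarrow> ('s set \<Rightarrow> 's set) \<Rightarrow> bool"
  where "shrinking P f \<longleftrightarrow> (\<forall>S. P S \<longrightarrow> P (f S) \<and> f S \<subseteq> S) \<and>
    (\<forall>\<S>. \<S> \<noteq> {} \<longrightarrow> (\<forall>S\<in>\<S>. P S) \<longrightarrow> P (\<Inter>\<S>))"

text \<open>Membership in \<open>P\<close> and monotonicity go through one induction: at a successor
  index \<open>f\<close> is known to shrink the previous stage only because that stage satisfies
  \<open>P\<close>.\<close>

lemma shrinking_titer_at:
  assumes wf: "wf (r - Id)" and r: "antisym r" "trans r" and f: "shrinking P f" and X: "P X"
  shows "P (titer_at r f X a) \<and> (\<forall>b\<in>underS r a. titer_at r f X a \<subseteq> titer_at r f X b)"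
  using wf
proof (induction a rule: wf_induct_rule)
  case (less a)
  let ?t = "titer_at r f X"
  have IH: "P (?t b)" "\<And>c. c \<in> underS r b \<Longrightarrow> ?t b \<subseteq> ?t c" if "b \<in> underS r a" for b
    using less[of b] that by (auto simp: underS_def)
  note unf = titer_at_unfold[OF wf r(1), of f X a]
  show ?case
  proof (cases "underS r a = {}")
    case True
    then show ?thesis using unf X by (auto simp: tstep_def)
  next
    case ne: False
    show ?thesis
    proof (cases "\<exists>m\<in>underS r a. \<forall>b\<in>underS r a. (b, m) \<in> r")
      case True
      then obtain m where m: "m \<in> underS r a" "\<And>b. b \<in> underS r a \<Longrightarrow> (b, m) \<in> r" by blast
      have eq: "?t a = f (?t m)"
        using unf tstep_max[OF r(1) m] by simp
      have "?t m \<subseteq> ?t b" if "b \<in> underS r a" for b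
        using m(2)[OF that] IH(2)[OF m(1), of b] by (cases "b = m") (auto simp: underS_def)
      then show ?thesis
        using f IH(1)[OF m(1)] unfolding shrinking_def eq by blast
    next
      case False
      have eq: "?t a = (\<Inter>b\<in>underS r a. ?t b)"
        using unf tstep_limit[OF ne] False by metis
      have "P (\<Inter>b\<in>underS r a. ?t b)"
        using f ne IH(1) unfolding shrinking_def by (metis (no_types, lifting) image_iff image_is_empty)
      then show ?thesis unfolding eq by blast
    qed
  qed
qed

section \<open>Iterates indexed by powers of omega\<close>

text \<open>\<open>omega_pow_iter r f x\<close> is the operation \<open>f\<close> iterated \<open>\<omega>\<^sup>\<xi>\<close> times,
  where \<open>\<xi>\<close> is the position of \<open>x\<close> in \<open>r\<close>.\<close>

definition omega_pow_iter :: "'i rel \<Rightarrow> ('s set \<Rightarrow> 's set) \<Rightarrow> 'i \<Rightarrow> 's set \<Rightarrow> 's set"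
  where "omega_pow_iter r f = wfrec (r - Id)
    (\<lambda>g x X. if underS r x = {} then f X else \<Inter>b\<in>underS r x. \<Inter>k. (g b ^^ k) X)"

lemma omega_pow_iter_unfold:
  assumes "wf (r - Id)"
  shows "omega_pow_iter r f x X = (if underS r x = {} then f X
    else \<Inter>b\<in>underS r x. \<Inter>k. (omega_pow_iter r f b ^^ k) X)"
proof -
  have c: "cut (omega_pow_iter r f) (r - Id) x b = omega_pow_iter r f b" if "b \<in> underS r x" for b
    using that by (auto simp: cut_def underS_def)
  have "omega_pow_iter r f x X = (if underS r x = {} then f X
    else \<Inter>b\<in>underS r x. \<Inter>k. (cut (omega_pow_iter r f) (r - Id) x b ^^ k) X)"
    unfolding omega_pow_iter_def by (subst wfrec[OF assms]) simp
  then show ?thesis using c by simp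
qed

lemma shrinking_funpow:
  assumes "shrinking P f" "P X"
  shows "P ((f ^^ k) X) \<and> (f ^^ k) X \<subseteq> X"
  using assms by (induction k) (auto simp: shrinking_def)

lemma funpow_shrinking_antimono:
  assumes "shrinking P f" "P X" "k \<le> l"
  shows "(f ^^ l) X \<subseteq> (f ^^ k) X"
proof -
  have "(f ^^ l) X = (f ^^ (l - k)) ((f ^^ k) X)"
    using assms(3) by (simp flip: funpow_add[THEN fun_cong, unfolded comp_def])
  then show ?thesis
    using shrinking_funpow[OF assms(1)] assms(2) by metis
qed

lemma shrinking_omega_pow_iter:
  assumes wf: "wf (r - Id)" and f: "shrinking P f"
  shows "shrinking P (omega_pow_iter r f x)"
  using wf
proof (induction x rule: wf_induct_rule)
  case (less x)
  have IH: "shrinking P (omega_pow_iter r f b)" if "b \<in> underS r x" for b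
    using less that by (auto simp: underS_def)
  show ?case
  proof (cases "underS r x = {}")
    case True
    then have "omega_pow_iter r f x = f"
      using omega_pow_iter_unfold[OF wf, of f x] by auto
    then show ?thesis using f by simp
  next
    case False
    then have eq: "omega_pow_iter r f x X =
        (\<Inter>(b, k)\<in>underS r x \<times> UNIV. (omega_pow_iter r f b ^^ k) X)" for X
      by (subst omega_pow_iter_unfold[OF wf]) auto
    have "P (omega_pow_iter r f x X) \<and> omega_pow_iter r f x X \<subseteq> X" if X: "P X" for X
    proof
      have Int: "P (\<Inter>\<S>)" if "\<S> \<noteq> {}" "\<forall>S\<in>\<S>. P S" for \<S>
        using f that by (auto simp: shrinking_def)
      show "P (omega_pow_iter r f x X)"
        unfolding eq using False shrinking_funpow[OF IH X] by (intro Int) auto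
      obtain b where b: "b \<in> underS r x" using False by blast
      show "omega_pow_iter r f x X \<subseteq> X"
        unfolding eq using shrinking_funpow[OF IH X, OF b] b by fastforce
    qed
    then show ?thesis using f by (auto simp: shrinking_def)
  qed
qed

lemma omega_pow_iter_subset:
  assumes "wf (r - Id)" "b \<in> underS r x"
  shows "omega_pow_iter r f x X \<subseteq> (omega_pow_iter r f b ^^ k) X"
  using assms by (subst omega_pow_iter_unfold[OF assms(1)]) auto

text \<open>\<open>h\<close> carries initial segments onto initial segments and the recursion at
  \<open>x\<close> reads only values below \<open>x\<close>, so the iterate depends only on the
  order type below the exponent.\<close>

lemma omega_pow_iter_embed:
  assumes wf: "wf (r - Id)" "wf (s - Id)"
    and h: "\<And>x. x \<in> Field r \<Longrightarrow> underS s (h x) = h ` underS r x"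
  shows "x \<in> Field r \<Longrightarrow> omega_pow_iter s f (h x) = omega_pow_iter r f x"
  using wf(1)
proof (induction x rule: wf_induct_rule)
  case (less x)
  have "omega_pow_iter s f (h b) = omega_pow_iter r f b" if "b \<in> underS r x" for b
    using less.IH[of b] that by (auto simp: underS_def intro: FieldI1)
  then show ?case
    using h[OF less.prems]
    by (intro ext) (simp add: omega_pow_iter_unfold[OF wf(1), of _ x] omega_pow_iter_unfold[OF wf(2), of _ "h x"])
qed

subsection \<open>The well-order of omega powers\<close>

definition fin_supp :: "'i rel \<Rightarrow> ('i \<Rightarrow> nat) \<Rightarrow> bool"
  where "fin_supp r p \<longleftrightarrow> finite {x. p x \<noteq> 0} \<and> {x. p x \<noteq> 0} \<subseteq> Field r"

lemma omega_exp_iff: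
  "(p, q) \<in> omega_exp r \<longleftrightarrow> fin_supp r p \<and> fin_supp r q \<and>
    (p = q \<or> (\<exists>x\<in>Field r. p x < q x \<and> (\<forall>y\<in>Field r. (x, y) \<in> r \<and> y \<noteq> x \<longrightarrow> p y = q y)))"
  by (auto simp: omega_exp_def fin_supp_def)

lemma Field_omega_exp: "Field (omega_exp r) = Collect (fin_supp r)"
  by (auto simp: Field_def omega_exp_iff)

lemma fin_supp_zero [simp]: "fin_supp r (\<lambda>_. 0)"
  by (simp add: fin_supp_def)

lemma fin_supp_upd [simp]:
  assumes "fin_supp r p" "x \<in> Field r"
  shows "fin_supp r (p(x := k))"
proof -
  have "{y. (p(x := k)) y \<noteq> 0} \<subseteq> insert x {y. p y \<noteq> 0}" by auto
  then show ?thesis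
    using assms unfolding fin_supp_def by (meson finite.insertI finite_subset insert_subset subset_trans)
qed

context
  fixes r :: "'i rel"
  assumes wo: "Well_order r"
begin

lemma Well_order_props: "wf (r - Id)" "antisym r" "trans r" "Total r" "Refl r"
  using wo by (auto simp: well_order_on_def linear_order_on_def partial_order_on_def preorder_on_def)

lemma Well_order_cases:
  assumes "x \<in> Field r" "y \<in> Field r"
  obtains "x = y" | "x \<in> underS r y" | "y \<in> underS r x"
  using Well_order_props(4) assms unfolding total_on_def underS_def by blast

lemma underS_trans: "z \<in> underS r y \<Longrightarrow> y \<in> underS r x \<Longrightarrow> z \<in> underS r x"
  using Well_order_props(2,3) unfolding underS_def by (auto dest: transD antisymD)

lemma underS_in_Field: "y \<in> underS r x \<Longrightarrow> y \<in> Field r"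
  by (auto simp: underS_def intro: FieldI1)

lemma underS_asym: "y \<in> underS r x \<Longrightarrow> x \<notin> underS r y"
  using Well_order_props(2) unfolding underS_def by (auto dest: antisymD)

section \<open>Comparison of finitely supported coefficient functions\<close>

lemma omega_exp_less_iff:
  "p \<in> underS (omega_exp r) q \<longleftrightarrow> fin_supp r p \<and> fin_supp r q \<and>
    (\<exists>x\<in>Field r. p x < q x \<and> (\<forall>y. x \<in> underS r y \<longrightarrow> p y = q y))"
proof -
  have "(\<forall>y\<in>Field r. (x, y) \<in> r \<and> y \<noteq> x \<longrightarrow> p y = q y) \<longleftrightarrow> (\<forall>y. x \<in> underS r y \<longrightarrow> p y = q y)" for x
    by (auto simp: underS_def intro: FieldI2)
  then have "p \<in> underS (omega_exp r) q \<longleftrightarrow> p \<noteq> q \<and> fin_supp r p \<and> fin_supp r q \<and>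
      (\<exists>x\<in>Field r. p x < q x \<and> (\<forall>y. x \<in> underS r y \<longrightarrow> p y = q y))"
    unfolding omega_exp_iff underS_def[of "omega_exp r"] mem_Collect_eq by blast
  then show ?thesis by (metis less_irrefl)
qed

lemma omega_exp_asym: "p \<in> underS (omega_exp r) q \<Longrightarrow> q \<notin> underS (omega_exp r) p"
  unfolding omega_exp_less_iff by (metis less_irrefl order_less_asym Well_order_cases)

text \<open>The larger of the two positions of leading difference serves for \<open>p\<close> and
  \<open>s\<close>.\<close>

lemma omega_exp_trans:
  assumes "p \<in> underS (omega_exp r) q" "q \<in> underS (omega_exp r) s"
  shows "p \<in> underS (omega_exp r) s"
proof -
  obtain x where x: "x \<in> Field r" "p x < q x" "\<And>y. x \<in> underS r y \<Longrightarrow> p y = q y"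
    using assms(1) unfolding omega_exp_less_iff by blast
  obtain z where z: "z \<in> Field r" "q z < s z" "\<And>y. z \<in> underS r y \<Longrightarrow> q y = s y"
    using assms(2) unfolding omega_exp_less_iff by blast
  have "\<exists>x\<in>Field r. p x < s x \<and> (\<forall>y. x \<in> underS r y \<longrightarrow> p y = s y)"
    using x(1) z(1)
  proof (cases rule: Well_order_cases)
    case 1
    then show ?thesis using x z by (metis order_less_trans)
  next
    case 2
    then show ?thesis using x z by (metis underS_trans)
  next
    case 3
    then show ?thesis using x z by (metis underS_trans)
  qed
  then show ?thesis using assms unfolding omega_exp_less_iff by blast
qed

lemma finite_has_greatest:
  assumes "finite A" "A \<noteq> {}" "A \<subseteq> Field r"
  shows "\<exists>m\<in>A. \<forall>y\<in>A. y = m \<or> y \<in> underS r m"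
  using assms
proof (induction A rule: finite_ne_induct)
  case (singleton x)
  then show ?case by simp
next
  case (insert x A)
  then obtain m where m: "m \<in> A" "\<And>y. y \<in> A \<Longrightarrow> y = m \<or> y \<in> underS r m" by auto
  have "x \<in> Field r" "m \<in> Field r" using insert.prems m(1) by auto
  then show ?case
  proof (cases rule: Well_order_cases)
    case 1
    then show ?thesis using m by blast
  next
    case 2
    then show ?thesis using m by blast
  next
    case 3
    then have "\<forall>y\<in>insert x A. y = x \<or> y \<in> underS r x" using m underS_trans by blast
    then show ?thesis by blast
  qed
qed

text \<open>As \<open>p\<close> has no terms of exponent below \<open>x\<close>, the updated
  function represents p + omega^x. The leading difference from \<open>q\<close> cannot lie below
  \<open>x\<close>; above \<open>x\<close> it also puts \<open>q\<close> below \<open>p\<close>; at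
  \<open>x\<close> it does so unless \<open>q x = p x\<close>.\<close>

lemma omega_exp_less_SucD:
  assumes "q \<in> underS (omega_exp r) (p(x := Suc (p x)))" and "fin_supp r p" and "x \<in> Field r"
    and "\<And>y. y \<in> underS r x \<Longrightarrow> p y = 0"
  shows "q \<in> underS (omega_exp r) p \<or> (\<forall>y. y \<notin> underS r x \<longrightarrow> q y = p y)"
proof -
  obtain z where z: "z \<in> Field r" "q z < (p(x := Suc (p x))) z"
      "\<And>y. z \<in> underS r y \<Longrightarrow> q y = (p(x := Suc (p x))) y" and q: "fin_supp r q"
    using assms(1) unfolding omega_exp_less_iff by blast
  have less: "q \<in> underS (omega_exp r) p" if "q z < p z" "\<And>y. z \<in> underS r y \<Longrightarrow> q y = p y"
    using that z(1) q assms(2) unfolding omega_exp_less_iff by blast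
  show ?thesis
    using z(1) assms(3)
  proof (cases rule: Well_order_cases)
    case 1
    have eq: "q y = p y" if "x \<in> underS r y" for y
      using z(3)[of y] that 1 by (auto simp: underS_def split: if_splits)
    have "q y = p y" if "y \<notin> underS r x" "q x = p x" for y
    proof (cases "y \<in> Field r")
      case True
      then show ?thesis using assms(3) that eq by (cases rule: Well_order_cases[OF True assms(3)]) auto
    next
      case False
      then show ?thesis using q assms(2) unfolding fin_supp_def by (metis (mono_tags, lifting) mem_Collect_eq subsetD)
    qed
    then show ?thesis
      using less eq z(2) 1 by (cases "q x = p x") auto
  next
    case 2
    then have "q z < p z" using z(2) by (auto simp: underS_def)
    then show ?thesis using assms(4)[OF 2] by simp
  next
    case 3
    then have "q z < p z" using z(2) by (auto simp: underS_def)
    moreover have "q y = p y" if "z \<in> underS r y" for y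
      using z(3)[OF that] underS_trans[OF 3 that] by (auto simp: underS_def split: if_splits)
    ultimately show ?thesis using less by blast
  qed
qed

section \<open>Well-foundedness of omega powers\<close>

text \<open>The coefficients on \<open>A\<close> are filled in from large exponents to small ones:
  the least exponent \<open>y\<close> of \<open>q\<close> in \<open>A\<close> is deleted, the
  induction hypothesis handles the rest, and \<open>q y\<close> uses of \<open>suc\<close> restore
  the coefficient.\<close>

lemma omega_exp_acc_fill:
  assumes suc: "\<And>y p. y \<in> A \<Longrightarrow> p \<in> Wellfounded.acc (omega_exp r - Id) \<Longrightarrow> fin_supp r p \<Longrightarrow>
      (\<And>z. z \<in> underS r y \<Longrightarrow> p z = 0) \<Longrightarrow> p(y := Suc (p y)) \<in> Wellfounded.acc (omega_exp r - Id)"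
    and A: "\<And>y z. y \<in> A \<Longrightarrow> z \<in> underS r y \<Longrightarrow> z \<in> A" "A \<subseteq> Field r"
    and p: "p \<in> Wellfounded.acc (omega_exp r - Id)" "fin_supp r p" "\<And>y. y \<in> A \<Longrightarrow> p y = 0"
  shows "fin_supp r q \<Longrightarrow> (\<And>y. y \<notin> A \<Longrightarrow> q y = p y) \<Longrightarrow> q \<in> Wellfounded.acc (omega_exp r - Id)"
proof (induction "card {y \<in> A. q y \<noteq> 0}" arbitrary: q rule: less_induct)
  case less
  let ?S = "{y \<in> A. q y \<noteq> 0}"
  have fin: "finite ?S"
    using less.prems(1) unfolding fin_supp_def by (rule conjE) (auto elim: finite_subset[rotated])
  show ?case
  proof (cases "?S = {}")
    case True
    then have "q = p" using less.prems(2) p(3) by (intro ext) fastforce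
    then show ?thesis using p by simp
  next
    case False
    then obtain y where y: "y \<in> ?S" "\<And>z. (z, y) \<in> r - Id \<Longrightarrow> z \<notin> ?S"
      using wfE_min'[OF Well_order_props(1) False] by blast
    have yF: "y \<in> Field r" using y(1) A(2) by auto
    have zero: "q z = 0" if "z \<in> underS r y" for z
      using y A(1)[of y z] that by (auto simp: underS_def)
    have "{z \<in> A. (q(y := 0)) z \<noteq> 0} \<subset> ?S" using y(1) by auto
    then have q': "q(y := 0) \<in> Wellfounded.acc (omega_exp r - Id)"
      using less.prems y(1) yF by (intro less.hyps psubset_card_mono[OF fin]) auto
    have "q(y := k) \<in> Wellfounded.acc (omega_exp r - Id)" for k
    proof (induction k)
      case 0
      then show ?case using q' .
    next
      case (Suc k)
      have "(q(y := k))(y := Suc ((q(y := k)) y)) \<in> Wellfounded.acc (omega_exp r - Id)"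
      proof (rule suc)
        show "y \<in> A" using y(1) by simp
        show "q(y := k) \<in> Wellfounded.acc (omega_exp r - Id)" by (rule Suc)
        show "fin_supp r (q(y := k))" using less.prems(1) yF by simp
        show "(q(y := k)) z = 0" if "z \<in> underS r y" for z
          using zero[OF that] that by (auto simp: underS_def)
      qed
      then show ?case by (simp only: fun_upd_upd fun_upd_same)
    qed
    from this[of "q y"] show ?thesis by simp
  qed
qed

text \<open>What lies below p + omega^x is below \<open>p\<close>, or is \<open>p\<close> with
  coefficients added at exponents below \<open>x\<close>. In the second case the induction
  hypothesis supplies the steps that \<open>omega_exp_acc_fill\<close> asks for.\<close>

lemma omega_exp_acc_Suc:
  "x \<in> Field r \<Longrightarrow> p \<in> Wellfounded.acc (omega_exp r - Id) \<Longrightarrow> fin_supp r p \<Longrightarrow>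
    (\<And>z. z \<in> underS r x \<Longrightarrow> p z = 0) \<Longrightarrow> p(x := Suc (p x)) \<in> Wellfounded.acc (omega_exp r - Id)"
  using Well_order_props(1)
proof (induction x arbitrary: p rule: wf_induct_rule)
  case (less x)
  show ?case
  proof (rule accI)
    fix q assume "(q, p(x := Suc (p x))) \<in> omega_exp r - Id"
    then have q: "q \<in> underS (omega_exp r) (p(x := Suc (p x)))" by (auto simp: underS_def)
    then consider "q \<in> underS (omega_exp r) p" | "\<forall>y. y \<notin> underS r x \<longrightarrow> q y = p y"
      using omega_exp_less_SucD less.prems by blast
    then show "q \<in> Wellfounded.acc (omega_exp r - Id)"
    proof cases
      case 1
      then show ?thesis
        using less.prems(2) by (auto simp: underS_def intro: acc_downward)
    next
      case 2
      show ?thesis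
      proof (rule omega_exp_acc_fill[where A = "underS r x" and p = p])
        show "p(y := Suc (p y)) \<in> Wellfounded.acc (omega_exp r - Id)"
          if "y \<in> underS r x" "p \<in> Wellfounded.acc (omega_exp r - Id)" "fin_supp r p"
            "\<And>z. z \<in> underS r y \<Longrightarrow> p z = 0" for y p
          using that(1) underS_in_Field by (intro less.IH that) (auto simp: underS_def)
        show "fin_supp r q" using q unfolding omega_exp_less_iff by blast
        show "z \<in> underS r x" if "y \<in> underS r x" "z \<in> underS r y" for y z
          using underS_trans[OF that(2,1)] .
        show "underS r x \<subseteq> Field r" using underS_in_Field by blast
        show "q y = p y" if "y \<notin> underS r x" for y using 2 that by blast
      qed (rule less.prems; assumption)+
    qed
  qed
qed

text \<open>Finitely supported functions are filled in from zero; all others lie outside the field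
  and have no predecessors.\<close>

lemma wf_omega_exp: "wf (omega_exp r - Id)"
proof (rule acc_wfI, rule allI)
  fix q :: "'i \<Rightarrow> nat"
  show "q \<in> Wellfounded.acc (omega_exp r - Id)"
  proof (cases "fin_supp r q")
    case True
    show ?thesis
    proof (rule omega_exp_acc_fill[where A = "Field r" and p = "\<lambda>_. 0"])
      show "p(y := Suc (p y)) \<in> Wellfounded.acc (omega_exp r - Id)"
        if "y \<in> Field r" "p \<in> Wellfounded.acc (omega_exp r - Id)" "fin_supp r p"
          "\<And>z. z \<in> underS r y \<Longrightarrow> p z = 0" for y p
        using omega_exp_acc_Suc that by blast
      show "(\<lambda>_. 0) \<in> Wellfounded.acc (omega_exp r - Id)"
        by (rule accI) (auto simp: omega_exp_iff)
      show "q y = 0" if "y \<notin> Field r" for y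
        using True that unfolding fin_supp_def by blast
    qed (use True underS_in_Field in auto)
  next
    case False
    then have "(p, q) \<notin> omega_exp r - Id" for p by (simp add: omega_exp_iff)
    then show ?thesis by (blast intro: accI)
  qed
qed

lemma antisym_omega_exp: "antisym (omega_exp r)"
proof (rule antisymI, rule ccontr)
  fix p q assume "(p, q) \<in> omega_exp r" "(q, p) \<in> omega_exp r" "p \<noteq> q"
  then have "p \<in> underS (omega_exp r) q" "q \<in> underS (omega_exp r) p"
    unfolding underS_def by blast+
  then show False using omega_exp_asym by blast
qed

lemma trans_omega_exp: "trans (omega_exp r)"
proof (rule transI)
  fix p q s assume "(p, q) \<in> omega_exp r" "(q, s) \<in> omega_exp r"
  then show "(p, s) \<in> omega_exp r"
    using omega_exp_trans[of p q s] by (cases "p = q"; cases "q = s") (auto simp: underS_def)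
qed

text \<open>The witness \<open>b\<close> is the largest exponent of \<open>q\<close> below
  \<open>x\<close>, or any exponent below \<open>x\<close> if there is none, and
  \<open>k = Suc (q b)\<close>. This cofinality identifies p + omega^x as a limit stage.\<close>

lemma omega_exp_cofinal:
  assumes "q \<in> underS (omega_exp r) (p(x := Suc (p x)))" "fin_supp r p" "x \<in> Field r"
    and "\<And>y. y \<in> underS r x \<Longrightarrow> p y = 0" and "underS r x \<noteq> {}"
  shows "\<exists>b\<in>underS r x. \<exists>k. q \<in> underS (omega_exp r) (p(b := k))"
proof -
  let ?S = "{y \<in> underS r x. q y \<noteq> 0}"
  have q: "fin_supp r q" using assms(1) unfolding omega_exp_less_iff by blast
  have fin: "finite ?S"
    using q unfolding fin_supp_def by (rule conjE) (auto elim: finite_subset[rotated])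
  have "?S \<subseteq> Field r" using underS_in_Field by auto
  then have "\<exists>b\<in>underS r x. \<forall>y\<in>?S. y = b \<or> y \<in> underS r b"
    using finite_has_greatest[OF fin] assms(5) by (cases "?S = {}") auto
  then obtain b where b: "b \<in> underS r x" "\<And>y. y \<in> ?S \<Longrightarrow> y = b \<or> y \<in> underS r b" by blast
  have bF: "b \<in> Field r" using b(1) underS_in_Field by blast
  then have F: "fin_supp r (p(b := Suc (q b)))" using assms(2) by simp
  have "q \<in> underS (omega_exp r) (p(b := Suc (q b)))"
    using omega_exp_less_SucD[OF assms(1-4)]
  proof
    assume "q \<in> underS (omega_exp r) p"
    then obtain z where z: "z \<in> Field r" "q z < p z" "\<And>y. z \<in> underS r y \<Longrightarrow> q y = p y"
      unfolding omega_exp_less_iff by blast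
    have "z \<notin> underS r x" using z(2) assms(4) by auto
    then have "b \<in> underS r z"
      using Well_order_cases[OF z(1) assms(3)] b(1) underS_trans by metis
    then have "q z < (p(b := Suc (q b))) z" "\<And>y. z \<in> underS r y \<Longrightarrow> q y = (p(b := Suc (q b))) y"
      using z underS_asym by (auto simp: underS_def)
    then show ?thesis using z(1) q F unfolding omega_exp_less_iff by blast
  next
    assume eq: "\<forall>y. y \<notin> underS r x \<longrightarrow> q y = p y"
    have "q y = (p(b := Suc (q b))) y" if "b \<in> underS r y" for y
    proof (cases "y \<in> underS r x")
      case True
      have "y \<notin> ?S" using b(2)[of y] that underS_asym by (auto simp: underS_def)
      then show ?thesis using True assms(4) that by (auto simp: underS_def)
    next
      case False
      then show ?thesis using eq b(1) by (auto simp: underS_def)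
    qed
    then show ?thesis using bF q F unfolding omega_exp_less_iff by (metis fun_upd_same lessI)
  qed
  then show ?thesis using b(1) by blast
qed

lemma omega_exp_upd_less:
  assumes "fin_supp r p" "x \<in> Field r" "b \<in> underS r x"
  shows "p(b := k) \<in> underS (omega_exp r) (p(x := Suc (p x)))"
proof -
  have "b \<in> Field r" using assms(3) underS_in_Field by blast
  moreover have "(p(b := k)) y = (p(x := Suc (p x))) y" if "x \<in> underS r y" for y
    using that assms(3) underS_asym[OF assms(3)] by (auto simp: underS_def)
  moreover have "(p(b := k)) x < (p(x := Suc (p x))) x"
    using assms(3) by (auto simp: underS_def)
  ultimately show ?thesis using assms(1,2) unfolding omega_exp_less_iff by auto
qed

section \<open>Stages of an iteration in Cantor normal form\<close>

text \<open>Passing from \<open>p\<close> to p + omega^x k means \<open>k\<close> further blocks of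
  omega^x steps. Each block is a single successor step if \<open>x\<close> is the least exponent,
  and otherwise a limit along p + omega^b k with \<open>b\<close> below \<open>x\<close>.\<close>

lemma titer_at_omega_exp_add:
  assumes f: "shrinking P f" and X: "P X"
  shows "x \<in> Field r \<Longrightarrow> fin_supp r p \<Longrightarrow> (\<And>y. y \<in> underS r x \<Longrightarrow> p y = 0) \<Longrightarrow>
    titer_at (omega_exp r) f X (p(x := p x + k)) =
      (omega_pow_iter r f x ^^ k) (titer_at (omega_exp r) f X p)"
  using Well_order_props(1)
proof (induction x arbitrary: p k rule: wf_induct_rule)
  case (less x)
  let ?t = "titer_at (omega_exp r) f X"
  note unf = titer_at_unfold[OF wf_omega_exp antisym_omega_exp, of f X]
  have dec: "?t p \<subseteq> ?t q" if "q \<in> underS (omega_exp r) p" for p q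
    using shrinking_titer_at[OF wf_omega_exp antisym_omega_exp trans_omega_exp f X] that by blast
  have step: "?t (p(x := Suc (p x))) = omega_pow_iter r f x (?t p)"
    if p: "fin_supp r p" "\<And>y. y \<in> underS r x \<Longrightarrow> p y = 0" for p
  proof (cases "underS r x = {}")
    case True
    \<comment> \<open>With no exponent below \<open>x\<close>, the index \<open>p\<close> is the
      immediate predecessor.\<close>
    have S: "q = p \<or> q \<in> underS (omega_exp r) p" if "q \<in> underS (omega_exp r) (p(x := Suc (p x)))" for q
      using omega_exp_less_SucD[OF that p(1) less.prems(1) p(2)] True by (auto intro: ext)
    have "p \<in> underS (omega_exp r) (p(x := Suc (p x)))"
      using p(1) less.prems(1) unfolding omega_exp_less_iff by (auto simp: underS_def)
    then have "?t (p(x := Suc (p x))) = f (?t p)"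
      using S p(1) by (subst unf, intro tstep_max[OF antisym_omega_exp]) (auto simp: underS_def omega_exp_iff)
    then show ?thesis
      using True omega_pow_iter_unfold[OF Well_order_props(1), of f x] by simp
  next
    case False
    let ?S = "underS (omega_exp r) (p(x := Suc (p x)))"
    have mem: "p(b := k) \<in> ?S" if "b \<in> underS r x" for b k
      using omega_exp_upd_less[OF p(1) less.prems(1) that] .
    have cof: "\<exists>b\<in>underS r x. \<exists>k. q \<in> underS (omega_exp r) (p(b := k))" if "q \<in> ?S" for q
      using omega_exp_cofinal[OF that p(1) less.prems(1) p(2) False] .
    have "?t (p(x := Suc (p x))) = (\<Inter>q\<in>?S. ?t q)"
    proof (subst unf, rule tstep_limit)
      show "?S \<noteq> {}" using mem False by blast
      fix m assume "m \<in> ?S"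
      then obtain b k where bk: "b \<in> underS r x" "m \<in> underS (omega_exp r) (p(b := k))"
        using cof by blast
      then have "(p(b := k), m) \<notin> omega_exp r"
        using omega_exp_asym[OF bk(2)] bk(2) by (auto simp: underS_def)
      then show "\<exists>q\<in>?S. (q, m) \<notin> omega_exp r" using mem[OF bk(1)] by blast
    qed
    also have "\<dots> = (\<Inter>b\<in>underS r x. \<Inter>k. ?t (p(b := k)))"
    proof (intro equalityI subsetI INT_I)
      fix \<phi> b k assume "\<phi> \<in> (\<Inter>q\<in>?S. ?t q)" "b \<in> underS r x"
      then show "\<phi> \<in> ?t (p(b := k))" using mem by blast
    next
      fix \<phi> q assume "\<phi> \<in> (\<Inter>b\<in>underS r x. \<Inter>k. ?t (p(b := k)))" "q \<in> ?S"
      then show "\<phi> \<in> ?t q" using cof[of q] dec by blast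
    qed
    also have "\<dots> = (\<Inter>b\<in>underS r x. \<Inter>k. (omega_pow_iter r f b ^^ k) (?t p))"
    proof (intro INF_cong refl)
      fix b k assume b: "b \<in> underS r x"
      have "?t (p(b := p b + k)) = (omega_pow_iter r f b ^^ k) (?t p)"
      proof (rule less.IH)
        show "(b, x) \<in> r - Id" using b by (auto simp: underS_def)
        show "p y = 0" if "y \<in> underS r b" for y
          using p(2) underS_trans[OF that b] .
      qed (use b p(1) underS_in_Field in auto)
      then show "?t (p(b := k)) = (omega_pow_iter r f b ^^ k) (?t p)"
        using p(2)[OF b] by simp
    qed
    also have "\<dots> = omega_pow_iter r f x (?t p)"
      using False omega_pow_iter_unfold[OF Well_order_props(1), of f x] by simp
    finally show ?thesis .
  qed
  show ?case
  proof (induction k)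
    case 0
    then show ?case by simp
  next
    case (Suc k)
    have "?t ((p(x := p x + k))(x := Suc ((p(x := p x + k)) x))) = omega_pow_iter r f x (?t (p(x := p x + k)))"
      using less.prems by (intro step) (auto simp: underS_def)
    then show ?case by (simp only: fun_upd_upd fun_upd_same Suc add_Suc_right funpow.simps o_apply)
  qed
qed

lemma titer_at_omega_exp_zero: "titer_at (omega_exp r) f X (\<lambda>_. 0) = X"
proof -
  have "underS (omega_exp r) (\<lambda>_. 0) = {}"
    unfolding omega_exp_less_iff set_eq_iff by simp
  then show ?thesis
    by (subst titer_at_unfold[OF wf_omega_exp antisym_omega_exp]) (simp add: tstep_def)
qed

lemma titer_at_omega_exp_multiple:
  assumes "shrinking P f" "P X" "x \<in> Field r"
  shows "titer_at (omega_exp r) f X ((\<lambda>_. 0)(x := k)) = (omega_pow_iter r f x ^^ k) X"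
  using titer_at_omega_exp_add[OF assms(1-3), of "\<lambda>_. 0" k] titer_at_omega_exp_zero[of f X] by simp

text \<open>Raising the leading coefficient by one and dropping all lower terms gives a larger
  index.\<close>

lemma omega_exp_less_multiple:
  assumes "fin_supp r p" "p \<noteq> (\<lambda>_. 0)"
  obtains x k where "x \<in> Field r" "p \<in> underS (omega_exp r) ((\<lambda>_. 0)(x := k))"
proof -
  let ?S = "{x. p x \<noteq> 0}"
  have "finite ?S" "?S \<noteq> {}" and Field: "?S \<subseteq> Field r"
    using assms by (auto simp: fin_supp_def)
  then obtain x where x: "x \<in> ?S" "\<And>y. y \<in> ?S \<Longrightarrow> y = x \<or> y \<in> underS r x"
    using finite_has_greatest by meson
  have xF: "x \<in> Field r" using x(1) Field by blast
  have "p y = ((\<lambda>_. 0)(x := Suc (p x))) y" if "x \<in> underS r y" for y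
    using x(2)[of y] that underS_asym by (auto simp: underS_def)
  then have "p \<in> underS (omega_exp r) ((\<lambda>_. 0)(x := Suc (p x)))"
    using xF assms(1) unfolding omega_exp_less_iff by (metis fin_supp_upd fin_supp_zero fun_upd_same lessI)
  then show ?thesis using that xF by blast
qed

text \<open>For nonzero \<open>r\<close> the multiples omega^x k with \<open>x\<close> below
  \<open>r\<close> are cofinal in omega^r, so the limit stage is an intersection along them.\<close>

lemma titer_omega_exp:
  assumes f: "shrinking P f" and X: "P X" and ne: "Field r \<noteq> {}"
  shows "titer (omega_exp r) f X = (\<Inter>x\<in>Field r. \<Inter>k. (omega_pow_iter r f x ^^ k) X)"
proof -
  let ?t = "titer_at (omega_exp r) f X"
  obtain x0 where x0: "x0 \<in> Field r" using ne by blast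
  have dec: "?t p \<subseteq> ?t q" if "q \<in> underS (omega_exp r) p" for p q
    using shrinking_titer_at[OF wf_omega_exp antisym_omega_exp trans_omega_exp f X] that by blast
  have cof: "\<exists>x\<in>Field r. \<exists>k. p \<in> underS (omega_exp r) ((\<lambda>_. 0)(x := k))" if p: "fin_supp r p" for p
  proof (cases "p = (\<lambda>_. 0)")
    case True
    have "p \<in> underS (omega_exp r) ((\<lambda>_. 0)(x0 := 1))"
      using x0 unfolding True omega_exp_less_iff by (auto simp: underS_def)
    then show ?thesis using x0 by blast
  next
    case False
    then show ?thesis using omega_exp_less_multiple[OF p] by metis
  qed
  have "titer (omega_exp r) f X = (\<Inter>p\<in>Field (omega_exp r). ?t p)"
    unfolding titer_def
  proof (rule tstep_limit)
    show "Field (omega_exp r) \<noteq> {}"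
      using fin_supp_zero[of r] unfolding Field_omega_exp by blast
    fix m assume "m \<in> Field (omega_exp r)"
    then obtain x k where xk: "x \<in> Field r" "m \<in> underS (omega_exp r) ((\<lambda>_. 0)(x := k))"
      using cof unfolding Field_omega_exp by blast
    then have "((\<lambda>_. 0)(x := k), m) \<notin> omega_exp r"
      using omega_exp_asym[OF xk(2)] xk(2) by (auto simp: underS_def)
    then show "\<exists>b\<in>Field (omega_exp r). (b, m) \<notin> omega_exp r"
      using xk(1) unfolding Field_omega_exp by (intro bexI[of _ "(\<lambda>_. 0)(x := k)"]) auto
  qed
  also have "\<dots> = (\<Inter>x\<in>Field r. \<Inter>k. ?t ((\<lambda>_. 0)(x := k)))"
  proof (intro equalityI subsetI INT_I)
    fix \<phi> x k assume "\<phi> \<in> (\<Inter>p\<in>Field (omega_exp r). ?t p)" "x \<in> Field r"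
    then show "\<phi> \<in> ?t ((\<lambda>_. 0)(x := k))" unfolding Field_omega_exp by auto
  next
    fix \<phi> p assume "\<phi> \<in> (\<Inter>x\<in>Field r. \<Inter>k. ?t ((\<lambda>_. 0)(x := k)))" "p \<in> Field (omega_exp r)"
    then show "\<phi> \<in> ?t p" using cof[of p] dec unfolding Field_omega_exp by blast
  qed
  also have "\<dots> = (\<Inter>x\<in>Field r. \<Inter>k. (omega_pow_iter r f x ^^ k) X)"
    using titer_at_omega_exp_multiple[OF f X] by simp
  finally show ?thesis .
qed

text \<open>Since omega^0 = 1, there is exactly one application of \<open>f\<close>.\<close>

lemma titer_omega_exp_empty:
  assumes "Field r = {}"
  shows "titer (omega_exp r) f X = f X"
proof -
  have "Field (omega_exp r) = {\<lambda>_. 0}"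
    using assms unfolding Field_omega_exp by (auto simp: fin_supp_def)
  moreover have "tstep f X (omega_exp r) {\<lambda>_. 0} (titer_at (omega_exp r) f X) =
      f (titer_at (omega_exp r) f X (\<lambda>_. 0))"
    by (rule tstep_max[OF antisym_omega_exp]) (auto simp: omega_exp_iff)
  ultimately show ?thesis
    by (simp only: titer_def titer_at_omega_exp_zero)
qed

end

section \<open>Transport of iterations along order embeddings\<close>

lemma tstep_image:
  assumes "antisym r" "antisym s" and le: "\<And>b c. b \<in> S \<Longrightarrow> c \<in> S \<Longrightarrow> (b, c) \<in> r \<longleftrightarrow> (e b, e c) \<in> s"
    and g: "\<And>b. b \<in> S \<Longrightarrow> g b = h (e b)"
  shows "tstep f X r S g = tstep f X s (e ` S) h"
proof (cases "S = {}")
  case True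
  then show ?thesis by (simp add: tstep_def)
next
  case ne: False
  show ?thesis
  proof (cases "\<exists>m\<in>S. \<forall>b\<in>S. (b, m) \<in> r")
    case True
    then obtain m where m: "m \<in> S" "\<And>b. b \<in> S \<Longrightarrow> (b, m) \<in> r" by blast
    have "tstep f X s (e ` S) h = f (h (e m))"
      using m le by (intro tstep_max[OF assms(2)]) auto
    then show ?thesis using tstep_max[OF assms(1) m, of f X g] g[OF m(1)] by simp
  next
    case False
    have "tstep f X s (e ` S) h = (\<Inter>b\<in>e ` S. h b)"
      using ne False le by (intro tstep_limit) auto
    moreover have "tstep f X r S g = (\<Inter>b\<in>S. g b)"
      using ne False by (intro tstep_limit) auto
    ultimately show ?thesis using g by simp
  qed
qed

text \<open>A strict embedding has a proper initial segment \<open>underS \<gamma> p\<close> as its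
  image, and the stages agree along it by induction. The index \<open>p\<close> is chosen before
  \<open>f\<close>, hence independently of epsilon.\<close>

lemma titer_ordLess:
  assumes "(\<beta>, \<gamma>) \<in> ordLess"
  obtains p where "p \<in> Field \<gamma>" "\<And>f X. titer \<beta> f X = titer_at \<gamma> f X p"
proof -
  obtain e where wo: "Well_order \<beta>" "Well_order \<gamma>" and eS: "embedS \<beta> \<gamma> e"
    using assms unfolding ordLess_def by blast
  have e: "embed \<beta> \<gamma> e" using eS unfolding embedS_def by blast
  have "wo_rel.ofilter \<gamma> (e ` Field \<beta>)"
    using embed_Field_ofilter[OF wo e] .
  moreover have "e ` Field \<beta> \<noteq> Field \<gamma>"
    using embedS_Field[OF wo(1) eS] by blast
  ultimately have "\<exists>p\<in>Field \<gamma>. e ` Field \<beta> = underS \<gamma> p"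
    using wo_rel.ofilter_underS_Field[of \<gamma>] wo(2) by (simp add: wo_rel_def)
  then obtain p where p: "p \<in> Field \<gamma>" "e ` Field \<beta> = underS \<gamma> p" by blast
  have inj: "inj_on e (Field \<beta>)" using embed_inj_on[OF wo(1) e] .
  have le: "(b, c) \<in> \<beta> \<longleftrightarrow> (e b, e c) \<in> \<gamma>" if "b \<in> Field \<beta>" "c \<in> Field \<beta>" for b c
  proof
    show "(e b, e c) \<in> \<gamma>" if "(b, c) \<in> \<beta>"
      using embed_compat[OF e] that unfolding compat_def by blast
    assume bc: "(e b, e c) \<in> \<gamma>"
    show "(b, c) \<in> \<beta>"
    proof (rule ccontr)
      assume "(b, c) \<notin> \<beta>"
      moreover from this have "b \<noteq> c"
        using Well_order_props(5)[OF wo(1)] that unfolding refl_on_def by auto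
      ultimately have "(c, b) \<in> \<beta>" "b \<noteq> c"
        using Well_order_props(4)[OF wo(1)] that unfolding total_on_def by auto
      then have "(e c, e b) \<in> \<gamma>"
        using embed_compat[OF e] unfolding compat_def by blast
      then have "e b = e c" using bc Well_order_props(2)[OF wo(2)] by (auto dest: antisymD)
      then show False using inj that \<open>b \<noteq> c\<close> by (auto dest: inj_onD)
    qed
  qed
  have at: "titer_at \<beta> f X a = titer_at \<gamma> f X (e a)" if "a \<in> Field \<beta>" for f :: "'c set \<Rightarrow> 'c set" and X a
    using Well_order_props(1)[OF wo(1)] that
  proof (induction a rule: wf_induct_rule)
    case (less a)
    have im: "e ` underS \<beta> a = underS \<gamma> (e a)"
      using embed_underS[OF wo(1) e less.prems] by (simp add: bij_betw_def)
    have F: "b \<in> Field \<beta>" if "b \<in> underS \<beta> a" for b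
      using that by (auto simp: underS_def intro: FieldI1)
    have "tstep f X \<beta> (underS \<beta> a) (titer_at \<beta> f X) = tstep f X \<gamma> (e ` underS \<beta> a) (titer_at \<gamma> f X)"
    proof (rule tstep_image[OF Well_order_props(2)[OF wo(1)] Well_order_props(2)[OF wo(2)]])
      show "(b, c) \<in> \<beta> \<longleftrightarrow> (e b, e c) \<in> \<gamma>"
        if "b \<in> underS \<beta> a" "c \<in> underS \<beta> a" for b c
        using le F that by blast
      show "titer_at \<beta> f X b = titer_at \<gamma> f X (e b)" if "b \<in> underS \<beta> a" for b
        using less.IH[of b] F[OF that] that by (simp add: underS_def)
    qed
    then show ?case
      unfolding im using titer_at_unfold[OF Well_order_props(1,2), OF wo(1) wo(1), of f X a]
        titer_at_unfold[OF Well_order_props(1,2), OF wo(2) wo(2), of f X "e a"] by simp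
  qed
  have "titer \<beta> f X = titer_at \<gamma> f X p" for f :: "'c set \<Rightarrow> 'c set" and X
  proof -
    have "titer \<beta> f X = tstep f X \<gamma> (e ` Field \<beta>) (titer_at \<gamma> f X)"
      unfolding titer_def
      by (rule tstep_image[OF Well_order_props(2)[OF wo(1)] Well_order_props(2)[OF wo(2)]]) (auto simp: le at)
    then show ?thesis
      unfolding p(2) using titer_at_unfold[OF Well_order_props(1,2), OF wo(2) wo(2), of f X p] by simp
  qed
  then show ?thesis using that p(1) by blast
qed

subsection \<open>Successor and predecessor exponents\<close>

lemma Field_osucc: "Field (osucc r) = insert None (Some ` Field r)"
  by (auto simp: osucc_def Field_def)

lemma Field_oneplus: "Field (oneplus r) = insert None (Some ` Field r)"
proof
  show "Field (oneplus r) \<subseteq> insert None (Some ` Field r)"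
    by (auto simp: oneplus_def Field_def)
  have "(None, Some x) \<in> oneplus r" if "x \<in> Field r" for x
    using that by (auto simp: oneplus_def)
  moreover have "(None, None) \<in> oneplus r" by (simp add: oneplus_def)
  ultimately show "insert None (Some ` Field r) \<subseteq> Field (oneplus r)"
    by (auto intro: FieldI1 FieldI2)
qed

lemma underS_osucc:
  "underS (osucc r) None = Some ` Field r"
  "underS (osucc r) (Some x) = Some ` underS r x"
  by (auto simp: osucc_def underS_def)

lemma underS_oneplus:
  "underS (oneplus r) None = {}"
  "x \<in> Field r \<Longrightarrow> underS (oneplus r) (Some x) = insert None (Some ` underS r x)"
  by (auto simp: oneplus_def underS_def)

lemma Well_order_osucc:
  assumes "Well_order r"
  shows "Well_order (osucc r)"
proof -
  note r = Well_order_props[OF assms]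
  \<comment> \<open>Old elements get rank 0 and the new top element rank 1; \<open>undefined\<close>
    only fills the second component.\<close>
  let ?m = "\<lambda>x. case x of Some y \<Rightarrow> (0::nat, y) | None \<Rightarrow> (1, undefined)"
  have "wf (inv_image (less_than <*lex*> (r - Id)) ?m)"
    using r(1) by (intro wf_inv_image wf_lex_prod) auto
  moreover have "osucc r - Id \<subseteq> inv_image (less_than <*lex*> (r - Id)) ?m"
    by (auto simp: osucc_def inv_image_def)
  ultimately have "wf (osucc r - Id)" by (rule wf_subset)
  moreover have "Refl (osucc r)"
    using r(5) unfolding refl_on_def Field_osucc by (auto simp: osucc_def)
  moreover have "trans (osucc r)"
  proof (rule transI)
    fix x y z assume "(x, y) \<in> osucc r" "(y, z) \<in> osucc r"
    then show "(x, z) \<in> osucc r"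
      using r(3) by (cases x; cases y; cases z) (auto simp: osucc_def intro: FieldI1 dest: transD)
  qed
  moreover have "antisym (osucc r)"
    using r(2) unfolding antisym_def by (auto simp: osucc_def)
  moreover have "Total (osucc r)"
    using r(4) unfolding total_on_def Field_osucc by (auto simp: osucc_def)
  ultimately show ?thesis
    by (auto simp: well_order_on_def linear_order_on_def partial_order_on_def preorder_on_def refl_on_def
        intro: FieldI1 FieldI2)
qed

lemma Well_order_oneplus:
  assumes "Well_order r"
  shows "Well_order (oneplus r)"
proof -
  note r = Well_order_props[OF assms]
  \<comment> \<open>The ranks are exchanged, since the new element is now the bottom.\<close>
  let ?m = "\<lambda>x. case x of Some y \<Rightarrow> (1::nat, y) | None \<Rightarrow> (0, undefined)"
  have "wf (inv_image (less_than <*lex*> (r - Id)) ?m)"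
    using r(1) by (intro wf_inv_image wf_lex_prod) auto
  moreover have "oneplus r - Id \<subseteq> inv_image (less_than <*lex*> (r - Id)) ?m"
    by (auto simp: oneplus_def inv_image_def)
  ultimately have "wf (oneplus r - Id)" by (rule wf_subset)
  moreover have "Refl (oneplus r)"
    using r(5) unfolding refl_on_def Field_oneplus by (auto simp: oneplus_def)
  moreover have "trans (oneplus r)"
  proof (rule transI)
    fix x y z assume "(x, y) \<in> oneplus r" "(y, z) \<in> oneplus r"
    then show "(x, z) \<in> oneplus r"
      using r(3) by (cases x; cases y; cases z) (auto simp: oneplus_def intro: FieldI2 dest: transD)
  qed
  moreover have "antisym (oneplus r)"
    using r(2) unfolding antisym_def by (auto simp: oneplus_def)
  moreover have "Total (oneplus r)"
    using r(4) unfolding total_on_def Field_oneplus by (auto simp: oneplus_def)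
  ultimately show ?thesis
    by (auto simp: well_order_on_def linear_order_on_def partial_order_on_def preorder_on_def refl_on_def
        intro: FieldI1 FieldI2)
qed

text \<open>In \<open>osucc r\<close> the element \<open>None\<close> has position \<open>r\<close>.
  Thus omega^r is given by an exponent inside a well-order, in one form for zero and nonzero
  \<open>r\<close>.\<close>

lemma titer_omega_exp_eq_pow_iter:
  assumes wo: "Well_order r" and f: "shrinking P f" "P X"
  shows "titer (omega_exp r) f X = omega_pow_iter (osucc r) f None X"
proof (cases "Field r = {}")
  case True
  then show ?thesis
    by (simp add: titer_omega_exp_empty[OF wo] underS_osucc
        omega_pow_iter_unfold[OF Well_order_props(1)[OF Well_order_osucc[OF wo]]])
next
  case False
  have "omega_pow_iter (osucc r) f (Some x) = omega_pow_iter r f x" if "x \<in> Field r" for x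
    using that by (intro omega_pow_iter_embed Well_order_props(1) Well_order_osucc wo) (auto simp: underS_osucc)
  then show ?thesis
    using False by (simp add: titer_omega_exp[OF wo f] underS_osucc
        omega_pow_iter_unfold[OF Well_order_props(1)[OF Well_order_osucc[OF wo]], of _ None])
qed

text \<open>\<open>\<omega>\<^sup>1\<^sup>+\<^sup>\<xi> = \<omega> \<cdot> \<omega>\<^sup>\<xi>\<close>; \<open>shift_exp\<close> identifies
  \<open>\<xi> \<le> \<alpha>\<close> with \<open>1 + \<xi>\<close> in \<open>(1 + \<alpha>) + 1\<close>.\<close>

definition shift_exp :: "'a option \<Rightarrow> 'a option option"
  where "shift_exp = map_option Some"

lemma shift_exp_Field: "x \<in> Field (osucc r) \<Longrightarrow> shift_exp x \<in> Field (osucc (oneplus r))"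
  by (auto simp: Field_osucc Field_oneplus shift_exp_def)

text \<open>Below 1 + xi there is, besides the shifted exponents, the exponent 0, which is
  \<open>Some None\<close>.\<close>

lemma underS_shift_exp:
  assumes "x \<in> Field (osucc r)"
  shows "underS (osucc (oneplus r)) (shift_exp x) = insert (Some None) (shift_exp ` underS (osucc r) x)"
  using assms by (cases x)
    (auto simp: shift_exp_def underS_osucc underS_oneplus Field_oneplus Field_osucc image_image)

lemma shrinking_omega_iterate:
  assumes f: "shrinking P f"
  shows "shrinking P (\<lambda>X. \<Inter>k. (f ^^ k) X)"
proof -
  have Int: "P (\<Inter>\<S>)" if "\<S> \<noteq> {}" "\<forall>S\<in>\<S>. P S" for \<S>
    using f that by (auto simp: shrinking_def)
  show ?thesis
    unfolding shrinking_def
  proof (intro conjI allI impI)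
    fix S assume "P S"
    then have "P ((f ^^ k) S)" "(f ^^ k) S \<subseteq> S" for k using shrinking_funpow[OF f] by auto
    then show "P (\<Inter>k. (f ^^ k) S)" by (auto intro!: Int)
    show "(\<Inter>k. (f ^^ k) S) \<subseteq> S" by (rule subset_trans[OF INF_lower[of 0]]) auto
  qed (use Int in blast)
qed

text \<open>Exponent 0 contributes the intersection of all finite iterates. If \<open>x\<close> is
  not minimal, the least exponent of \<open>osucc r\<close> contributes a set contained in it, so
  the additional term is absorbed.\<close>

lemma omega_pow_iter_shift:
  assumes wo: "Well_order r" and f: "shrinking P f"
  shows "x \<in> Field (osucc r) \<Longrightarrow> P X \<Longrightarrow> omega_pow_iter (osucc (oneplus r)) f (shift_exp x) X =
    omega_pow_iter (osucc r) (\<lambda>X. \<Inter>k. (f ^^ k) X) x X"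
proof -
  let ?F = "\<lambda>X. \<Inter>k. (f ^^ k) X"
  note wf1 = Well_order_props(1)[OF Well_order_osucc[OF wo]]
  note wf2 = Well_order_props(1)[OF Well_order_osucc[OF Well_order_oneplus[OF wo]]]
  note F = shrinking_omega_iterate[OF f]
  have bot: "omega_pow_iter (osucc (oneplus r)) f (Some None) = f"
    by (intro ext) (simp add: omega_pow_iter_unfold[OF wf2] underS_osucc underS_oneplus)
  show "x \<in> Field (osucc r) \<Longrightarrow> P X \<Longrightarrow> omega_pow_iter (osucc (oneplus r)) f (shift_exp x) X =
      omega_pow_iter (osucc r) ?F x X"
    using wf1
  proof (induction x arbitrary: X rule: wf_induct_rule)
    case (less x)
    let ?J = "omega_pow_iter (osucc r) ?F"
    have IH: "(omega_pow_iter (osucc (oneplus r)) f (shift_exp b) ^^ k) X = (?J b ^^ k) X"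
      if b: "b \<in> underS (osucc r) x" for b k
    proof (induction k)
      case (Suc k)
      have "P ((?J b ^^ k) X)"
        using shrinking_funpow[OF shrinking_omega_pow_iter[OF wf1 F]] less.prems(2) by blast
      then show ?case
        using Suc less.IH[of b "(?J b ^^ k) X"] b by (auto simp: underS_def intro: FieldI1)
    qed simp
    have eq: "omega_pow_iter (osucc (oneplus r)) f (shift_exp x) X =
        ?F X \<inter> (\<Inter>b\<in>underS (osucc r) x. \<Inter>k. (?J b ^^ k) X)"
      by (subst omega_pow_iter_unfold[OF wf2]) (simp add: underS_shift_exp[OF less.prems(1)] bot IH)
    show ?case
    proof (cases "underS (osucc r) x = {}")
      case True
      then show ?thesis unfolding eq by (simp add: omega_pow_iter_unfold[OF wf1])
    next
      case False
      \<comment> \<open>\<open>b\<close> is the least exponent; there the iterate is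
        \<open>?F\<close> itself.\<close>
      then obtain b where b: "b \<in> underS (osucc r) x"
          "\<And>c. (c, b) \<in> osucc r - Id \<Longrightarrow> c \<notin> underS (osucc r) x"
        using wfE_min'[OF wf1 False] by blast
      have "underS (osucc r) b = {}"
        using b underS_trans[OF Well_order_osucc[OF wo] _ b(1)] by (auto simp: underS_def)
      then have "?J b = ?F"
        by (intro ext) (simp add: omega_pow_iter_unfold[OF wf1, of _ b])
      then have sub: "?J x X \<subseteq> ?F X"
        using omega_pow_iter_subset[OF wf1 b(1), of ?F X 1] by simp
      have "?J x X = (\<Inter>b\<in>underS (osucc r) x. \<Inter>k. (?J b ^^ k) X)"
        using False omega_pow_iter_unfold[OF wf1, of ?F x X] by simp
      then show ?thesis
        unfolding eq using Int_absorb1[OF sub] by simp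
    qed
  qed
qed

section \<open>Lower bound\<close>

text \<open>A compact Hausdorff space is normal, and a Urysohn function is bounded, so it lives in
  the type of bounded continuous functions that represents C(K).\<close>

lemma Urysohn_bcontfun:
  fixes S T :: "'a::t2_space set"
  assumes K: "compact (UNIV :: 'a set)" and "closed S" "closed T" "S \<inter> T = {}" "a \<le> b"
  obtains f :: "'a \<Rightarrow>\<^sub>C real"
  where "\<And>x. a \<le> f x" "\<And>x. f x \<le> b" "\<And>x. x \<in> S \<Longrightarrow> f x = a" "\<And>x. x \<in> T \<Longrightarrow> f x = b"
proof -
  have "compact_space (euclidean :: 'a topology)"
    using K by (simp add: compact_space_def)
  moreover have "Hausdorff_space (euclidean :: 'a topology)"
    unfolding Hausdorff_space_def disjnt_def by (metis hausdorff open_openin)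
  ultimately have "normal_space (euclidean :: 'a topology)"
    by (blast intro: compact_Hausdorff_or_regular_imp_normal_space)
  moreover have "closedin euclidean S" "closedin euclidean T" "disjnt S T"
    using assms by (auto simp: disjnt_def)
  ultimately obtain f where f: "continuous_map euclidean (top_of_set {a..b}) f" "f ` S \<subseteq> {a}" "f ` T \<subseteq> {b}"
    using Urysohn_lemma \<open>a \<le> b\<close> by metis
  then have cont: "continuous_on UNIV f" and range: "\<And>x. a \<le> f x \<and> f x \<le> b"
    by (auto simp: continuous_map_in_subtopology)
  have "f \<in> bcontfun"
  proof (rule bcontfun_normI[OF cont])
    show "norm (f x) \<le> max \<bar>a\<bar> \<bar>b\<bar>" for x using range[of x] by auto
  qed
  then obtain g where "f = apply_bcontfun g" by (rule bcontfunE)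
  then show ?thesis using range f(2,3) by (intro that[of g]) auto
qed

lemma abs_apply_le_norm: "\<bar>apply_bcontfun f x\<bar> \<le> norm f" for f :: "'a::topological_space \<Rightarrow>\<^sub>C real"
  using norm_bounded[of f x] by simp

definition point_eval :: "'a::topological_space \<Rightarrow> ('a \<Rightarrow>\<^sub>C real) \<Rightarrow>\<^sub>L real"
  where "point_eval z = Blinfun (\<lambda>f :: 'a \<Rightarrow>\<^sub>C real. f z)"

lemma point_eval_apply [simp]: "blinfun_apply (point_eval z) f = f z"
proof -
  have "bounded_linear (\<lambda>f :: 'a \<Rightarrow>\<^sub>C real. f z)"
    by (intro bounded_linear_intro[where K = 1]) (auto simp: abs_apply_le_norm)
  then show ?thesis by (simp add: point_eval_def bounded_linear_Blinfun_apply)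
qed

lemma norm_point_eval_le: "norm (point_eval z) \<le> 1"
  by (intro norm_blinfun_bound) (auto simp: abs_apply_le_norm)

text \<open>Intersections of the dual ball with weak* closed half-spaces: convexity and weak* closedness
  are both read off this description.\<close>

definition halfspace_closed :: "('x::real_normed_vector \<Rightarrow>\<^sub>L real) set \<Rightarrow> bool"
  where "halfspace_closed L \<longleftrightarrow> L \<subseteq> dual_ball \<and>
    (\<forall>\<phi>. \<phi> \<notin> L \<longrightarrow> (\<exists>x t. t < \<phi> x \<and> (\<forall>\<psi>\<in>L. \<psi> x \<le> t)))"

section \<open>Half-space closed sets under the derivation\<close>

lemma dz_deriv_subset: "dz_deriv \<epsilon> L \<subseteq> L"
  by (auto simp: dz_deriv_def)

lemma dz_deriv_mem_iff:
  "\<phi> \<in> dz_deriv \<epsilon> L \<longleftrightarrow> \<phi> \<in> L \<and> (\<forall>x t. t < \<phi> x \<longrightarrow> \<epsilon> \<le> diameter (wslice x t L))"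
proof -
  have "\<phi> \<in> dz_deriv \<epsilon> L \<longleftrightarrow>
      \<phi> \<in> L \<and> (\<forall>x t. \<phi> \<in> wslice x t L \<and> wslice x t L \<noteq> {} \<longrightarrow> \<epsilon> \<le> diameter (wslice x t L))"
    unfolding dz_deriv_def not_less[symmetric] by blast
  also have "\<dots> \<longleftrightarrow> \<phi> \<in> L \<and> (\<forall>x t. t < \<phi> x \<longrightarrow> \<epsilon> \<le> diameter (wslice x t L))"
    unfolding wslice_def by blast
  finally show ?thesis .
qed

text \<open>A norm above 1 is witnessed by a vector \<open>x\<close> with
  \<open>norm x < norm (\<phi> x)\<close>; after a change of sign it separates \<open>\<phi>\<close>
  from the ball at level \<open>norm x\<close>.\<close>

lemma halfspace_closed_dual_ball: "halfspace_closed dual_ball"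
  unfolding halfspace_closed_def
proof (intro conjI allI impI subset_refl)
  fix \<phi> :: "'a \<Rightarrow>\<^sub>L real" assume "\<phi> \<notin> dual_ball"
  then have "\<not> norm \<phi> \<le> 1" by (simp add: dual_ball_def)
  then obtain x where x: "norm x < norm (\<phi> x)"
    using norm_blinfun_bound[of 1 \<phi>] by (metis mult_1 not_le zero_le_one)
  define y where "y = sgn (\<phi> x) *\<^sub>R x"
  have y: "\<phi> y = \<bar>\<phi> x\<bar>" "norm y \<le> norm x"
    by (auto simp: y_def blinfun.scaleR_right abs_sgn mult.commute abs_sgn_eq)
  have "\<psi> y \<le> norm x" if "\<psi> \<in> dual_ball" for \<psi> :: "'a \<Rightarrow>\<^sub>L real"
  proof -
    have "norm (\<psi> y) \<le> norm \<psi> * norm y" by (rule norm_blinfun)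
    also have "\<dots> \<le> 1 * norm x" using that y by (intro mult_mono) (auto simp: dual_ball_def)
    finally show ?thesis by simp
  qed
  moreover have "norm x < \<phi> y" using x y by simp
  ultimately show "\<exists>x t. t < \<phi> x \<and> (\<forall>\<psi>\<in>dual_ball. \<psi> x \<le> t)" by blast
qed

text \<open>A deleted functional lies in a small slice that is deleted as a whole, so the half-space
  of this slice separates it from what remains.\<close>

lemma shrinking_halfspace_closed: "shrinking halfspace_closed (dz_deriv \<epsilon>)"
  unfolding shrinking_def
proof (intro conjI allI impI dz_deriv_subset)
  fix L :: "('a \<Rightarrow>\<^sub>L real) set" assume L: "halfspace_closed L"
  show "halfspace_closed (dz_deriv \<epsilon> L)"
    unfolding halfspace_closed_def
  proof (intro conjI allI impI)
    show "dz_deriv \<epsilon> L \<subseteq> dual_ball"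
      using L dz_deriv_subset unfolding halfspace_closed_def by blast
    fix \<phi> assume "\<phi> \<notin> dz_deriv \<epsilon> L"
    then consider "\<phi> \<notin> L" | x t where "t < \<phi> x" "diameter (wslice x t L) < \<epsilon>"
      unfolding dz_deriv_mem_iff by (auto simp: not_le)
    then show "\<exists>x t. t < \<phi> x \<and> (\<forall>\<psi>\<in>dz_deriv \<epsilon> L. \<psi> x \<le> t)"
    proof cases
      case 1
      then show ?thesis using L dz_deriv_subset unfolding halfspace_closed_def by blast
    next
      case 2
      then have "\<forall>\<psi>\<in>dz_deriv \<epsilon> L. \<psi> x \<le> t"
        by (auto simp: dz_deriv_mem_iff simp flip: not_less)
      then show ?thesis using 2 by blast
    qed
  qed
next
  fix \<S> :: "('a \<Rightarrow>\<^sub>L real) set set" assume "\<S> \<noteq> {}" and L: "\<forall>S\<in>\<S>. halfspace_closed S"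
  show "halfspace_closed (\<Inter>\<S>)"
    unfolding halfspace_closed_def
  proof (intro conjI allI impI)
    show "\<Inter>\<S> \<subseteq> dual_ball"
      using \<open>\<S> \<noteq> {}\<close> L unfolding halfspace_closed_def by (meson Inf_less_eq)
    fix \<phi> assume "\<phi> \<notin> \<Inter>\<S>"
    then obtain S where S: "S \<in> \<S>" "\<phi> \<notin> S" by blast
    moreover have "halfspace_closed S" using L S(1) by blast
    ultimately obtain x t where "t < \<phi> x" "\<forall>\<psi>\<in>S. \<psi> x \<le> t"
      unfolding halfspace_closed_def by blast
    then show "\<exists>x t. t < \<phi> x \<and> (\<forall>\<psi>\<in>\<Inter>\<S>. \<psi> x \<le> t)"
      using S(1) by (intro exI[of _ x] exI[of _ t]) auto
  qed
qed

lemma halfspace_closed_midpoint: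
  assumes L: "halfspace_closed L" and "\<phi>1 \<in> L" "\<phi>2 \<in> L"
  shows "(1/2) *\<^sub>R (\<phi>1 + \<phi>2) \<in> L"
proof (rule ccontr)
  assume "(1/2) *\<^sub>R (\<phi>1 + \<phi>2) \<notin> L"
  then obtain x t where "t < ((1/2) *\<^sub>R (\<phi>1 + \<phi>2)) x" "\<forall>\<psi>\<in>L. \<psi> x \<le> t"
    using L unfolding halfspace_closed_def by blast
  moreover from this have "\<phi>1 x \<le> t" "\<phi>2 x \<le> t" using assms(2,3) by auto
  ultimately show False by (simp add: blinfun.add_left blinfun.scaleR_left)
qed

text \<open>A slice containing the midpoint contains one of the endpoints, whose distance from the
  midpoint is at least \<open>\<epsilon>\<close>.\<close>

lemma midpoint_mem_dz_deriv:
  assumes L: "halfspace_closed L" and \<phi>: "\<phi>1 \<in> L" "\<phi>2 \<in> L" and far: "2 * \<epsilon> \<le> norm (\<phi>1 - \<phi>2)"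
  shows "(1/2) *\<^sub>R (\<phi>1 + \<phi>2) \<in> dz_deriv \<epsilon> L"
  unfolding dz_deriv_mem_iff
proof (intro conjI allI impI)
  let ?m = "(1/2) *\<^sub>R (\<phi>1 + \<phi>2)"
  show m: "?m \<in> L" using halfspace_closed_midpoint[OF L \<phi>] .
  fix x t assume t: "t < ?m x"
  then have "t < \<phi>1 x \<or> t < \<phi>2 x"
    by (auto simp: blinfun.add_left blinfun.scaleR_left)
  then obtain \<phi> where \<phi>': "t < blinfun_apply \<phi> x" "\<phi> \<in> {\<phi>1, \<phi>2}" by blast
  have "dist ?m \<phi> = norm (\<phi>1 - \<phi>2) / 2"
  proof -
    have "?m - \<phi>1 = - ((1/2) *\<^sub>R (\<phi>1 - \<phi>2))" "?m - \<phi>2 = (1/2) *\<^sub>R (\<phi>1 - \<phi>2)"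
      by (auto simp: algebra_simps) (simp_all flip: scaleR_add_left)
    then have "norm (?m - \<phi>1) = norm (\<phi>1 - \<phi>2) / 2" "norm (?m - \<phi>2) = norm (\<phi>1 - \<phi>2) / 2"
      by (simp_all only: norm_minus_cancel norm_scaleR)
    then show ?thesis using \<phi>'(2) by (auto simp: dist_norm)
  qed
  moreover have "bounded (wslice x t L)"
    using L unfolding halfspace_closed_def dual_ball_def wslice_def
    by (intro boundedI[where B = 1]) auto
  then have "dist ?m \<phi> \<le> diameter (wslice x t L)"
    using t m \<phi> \<phi>' by (intro diameter_bounded_bound) (auto simp: wslice_def)
  ultimately show "\<epsilon> \<le> diameter (wslice x t L)" using far by linarith
qed

text \<open>Averages of \<open>2\<^sup>k\<close> point masses are roots of dyadic trees with separated branches.\<close>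

lemma average_point_evals_mem:
  fixes C :: "'a::t2_space set"
  assumes K: "compact (UNIV :: 'a set)" and L: "halfspace_closed L"
    and C: "\<And>y. y \<in> C \<Longrightarrow> \<psi> + c *\<^sub>R point_eval y \<in> L"
  shows "finite S \<Longrightarrow> S \<subseteq> C \<Longrightarrow> card S = 2 ^ k \<Longrightarrow>
    \<psi> + (c / 2 ^ k) *\<^sub>R (\<Sum>y\<in>S. point_eval y) \<in> (dz_deriv \<bar>c\<bar> ^^ k) L"
proof (induction k arbitrary: S)
  case 0
  then obtain y where "S = {y}" using card_1_singletonE by auto
  then show ?case using 0 C by simp
next
  case (Suc k)
  have "2 ^ k \<le> card S" using Suc.prems(3) by simp
  then obtain S1 where S1: "S1 \<subseteq> S" "card S1 = 2 ^ k" "finite S1"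
    by (rule obtain_subset_with_card_n)
  define S2 where "S2 = S - S1"
  have S2: "finite S2" "card S2 = 2 ^ k" "S2 \<subseteq> C" "S = S1 \<union> S2" "S1 \<inter> S2 = {}"
    using S1 Suc.prems by (auto simp: S2_def card_Diff_subset)
  let ?a = "\<lambda>S. \<psi> + (c / 2 ^ k) *\<^sub>R (\<Sum>y\<in>S. point_eval y)"
  let ?L = "(dz_deriv \<bar>c\<bar> ^^ k) L"
  have mem: "?a S1 \<in> ?L" "?a S2 \<in> ?L"
    using S1 S2 Suc.prems(2) by (auto intro!: Suc.IH)
  have hL: "halfspace_closed ?L"
    using shrinking_funpow[OF shrinking_halfspace_closed L] by blast
  have "closed S1" "closed S2" using S1(3) S2(1) by (auto intro: finite_imp_closed)
  \<comment> \<open>The two averages differ by \<open>2 * c\<close> on a function that is 1 on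
    \<open>S1\<close> and -1 on \<open>S2\<close>; this is the separation needed for their
    midpoint.\<close>
  then obtain f :: "'a \<Rightarrow>\<^sub>C real" where f: "\<And>x. -1 \<le> f x" "\<And>x. f x \<le> 1"
      "\<And>x. x \<in> S2 \<Longrightarrow> f x = -1" "\<And>x. x \<in> S1 \<Longrightarrow> f x = 1"
    using Urysohn_bcontfun[OF K, of S2 S1 "-1" 1] S2(5) by (auto simp: Int_commute)
  have nf: "norm f \<le> 1"
    using f(1,2) by (intro norm_bound) (simp add: abs_le_iff minus_le_iff)
  have "(?a S1 - ?a S2) f = 2 * c"
    using f(3,4) S1(2) S2(2)
    by (simp add: blinfun.diff_left blinfun.add_left blinfun.scaleR_left blinfun.sum_left)
  then have "2 * \<bar>c\<bar> = norm ((?a S1 - ?a S2) f)" by simp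
  also have "\<dots> \<le> norm (?a S1 - ?a S2) * norm f" by (rule norm_blinfun)
  also have "\<dots> \<le> norm (?a S1 - ?a S2)" using nf by (simp add: mult_left_le)
  finally have "(1/2) *\<^sub>R (?a S1 + ?a S2) \<in> dz_deriv \<bar>c\<bar> ?L"
    using midpoint_mem_dz_deriv[OF hL mem] by simp
  moreover have "(1/2) *\<^sub>R (?a S1 + ?a S2) = \<psi> + (c / 2 ^ Suc k) *\<^sub>R (\<Sum>y\<in>S. point_eval y)"
    unfolding S2(4) using S1(3) S2(1,5)
    by (simp add: sum.union_disjoint algebra_simps flip: scaleR_add_left)
  ultimately show ?case by simp
qed

text \<open>If the functional were lost, a half-space would separate it from the \<open>k\<close>-th
  derivation, and the same strict inequality would hold at infinitely many points of
  \<open>C\<close> near \<open>z\<close>. An average over \<open>2 ^ k\<close> of them would then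
  violate the half-space although it survives.\<close>

lemma islimpt_point_eval_mem:
  fixes C :: "'a::t2_space set"
  assumes K: "compact (UNIV :: 'a set)" and L: "halfspace_closed L"
    and C: "\<And>y. y \<in> C \<Longrightarrow> \<psi> + c *\<^sub>R point_eval y \<in> L" and z: "z islimpt C"
  shows "\<psi> + c *\<^sub>R point_eval z \<in> (dz_deriv \<bar>c\<bar> ^^ k) L"
proof (rule ccontr)
  assume "\<psi> + c *\<^sub>R point_eval z \<notin> (dz_deriv \<bar>c\<bar> ^^ k) L"
  moreover have "halfspace_closed ((dz_deriv \<bar>c\<bar> ^^ k) L)"
    using shrinking_funpow[OF shrinking_halfspace_closed L] by blast
  ultimately obtain x t where x: "t < (\<psi> + c *\<^sub>R point_eval z) x"
      "\<And>\<phi>. \<phi> \<in> (dz_deriv \<bar>c\<bar> ^^ k) L \<Longrightarrow> \<phi> x \<le> t"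
    unfolding halfspace_closed_def by blast
  define U where "U = {y. t < \<psi> x + c * x y}"
  have "open U"
    unfolding U_def by (intro open_Collect_less continuous_intros) auto
  moreover have "z \<in> U"
    using x(1) by (simp add: U_def blinfun.add_left blinfun.scaleR_left)
  ultimately have "infinite (C \<inter> U)"
    using z unfolding islimpt_eq_acc_point by (metis Int_commute)
  then obtain S where S: "S \<subseteq> C \<inter> U" "finite S" "card S = 2 ^ k"
    by (metis infinite_arbitrarily_large)
  have "(\<psi> + (c / 2 ^ k) *\<^sub>R (\<Sum>y\<in>S. point_eval y)) x \<le> t"
    using S by (intro x(2) average_point_evals_mem[OF K L C]) auto
  moreover have "t * 2 ^ k < (\<Sum>y\<in>S. \<psi> x + c * x y)"
  proof -
    have "(\<Sum>y\<in>S. t) < (\<Sum>y\<in>S. \<psi> x + c * x y)"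
      using S by (intro sum_strict_mono) (auto simp: U_def)
    then show ?thesis using S(3) by (simp add: mult.commute)
  qed
  ultimately show False
    using S(3) by (simp add: blinfun.add_left blinfun.scaleR_left blinfun.sum_left sum.distrib
        sum_distrib_left[symmetric] field_simps)
qed

abbreviation dz_omega :: "real \<Rightarrow> ('x::real_normed_vector \<Rightarrow>\<^sub>L real) set \<Rightarrow> ('x \<Rightarrow>\<^sub>L real) set"
  where "dz_omega \<epsilon> L \<equiv> \<Inter>k. (dz_deriv \<epsilon> ^^ k) L"

text \<open>One derived set is matched with omega derivations; transfinite induction matches omega^x
  derived sets with equally many applications of \<open>dz_omega\<close>.\<close>

lemma point_eval_mem_omega_pow_iter:
  fixes C :: "'a::t2_space set"
  assumes K: "compact (UNIV :: 'a set)" and wf: "wf (r - Id)"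
  shows "halfspace_closed L \<Longrightarrow> (\<And>y. y \<in> C \<Longrightarrow> \<psi> + c *\<^sub>R point_eval y \<in> L) \<Longrightarrow>
    z \<in> omega_pow_iter r derived_set x C \<Longrightarrow>
    \<psi> + c *\<^sub>R point_eval z \<in> omega_pow_iter r (dz_omega \<bar>c\<bar>) x L"
  using wf
proof (induction x arbitrary: L C z rule: wf_induct_rule)
  case (less x)
  show ?case
  proof (cases "underS r x = {}")
    case True
    then show ?thesis
      using less.prems islimpt_point_eval_mem[OF K less.prems(1,2)]
      by (simp add: omega_pow_iter_unfold[OF wf] derived_set_def)
  next
    case False
    have "\<psi> + c *\<^sub>R point_eval y \<in> (omega_pow_iter r (dz_omega \<bar>c\<bar>) b ^^ k) L"
      if "b \<in> underS r x" "y \<in> (omega_pow_iter r derived_set b ^^ k) C" for b k y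
      using that(2)
    proof (induction k arbitrary: y)
      case 0
      then show ?case using less.prems by simp
    next
      case (Suc k)
      have "halfspace_closed ((omega_pow_iter r (dz_omega \<bar>c\<bar>) b ^^ k) L)"
        using shrinking_funpow[OF shrinking_omega_pow_iter[OF wf shrinking_omega_iterate[OF
          shrinking_halfspace_closed]] less.prems(1)] by blast
      then show ?case
        using Suc that(1) less.IH[of b "(omega_pow_iter r (dz_omega \<bar>c\<bar>) b ^^ k) L"
            "(omega_pow_iter r derived_set b ^^ k) C" y]
        by (simp add: underS_def)
    qed
    then show ?thesis
      using less.prems(3) False by (simp add: omega_pow_iter_unfold[OF wf])
  qed
qed

text \<open>Each block of derivations keeps a ball around 0 whose radius is smaller by
  \<open>1 / n\<close>, so the origin remains after \<open>n\<close> blocks.\<close>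

lemma zero_mem_omega_pow_iter:
  fixes z :: "'a::t2_space"
  assumes K: "compact (UNIV :: 'a set)" and wf: "wf (r - Id)"
    and z: "z \<in> omega_pow_iter r derived_set x UNIV" and n: "0 < n"
  shows "0 \<in> (omega_pow_iter r (dz_omega (1 / real n)) x ^^ n) (dual_ball :: (('a \<Rightarrow>\<^sub>C real) \<Rightarrow>\<^sub>L real) set)"
proof -
  let ?W = "omega_pow_iter r (dz_omega (1 / real n)) x"
  let ?B = "dual_ball :: (('a \<Rightarrow>\<^sub>C real) \<Rightarrow>\<^sub>L real) set"
  have hW: "halfspace_closed ((?W ^^ j) ?B)" for j
    using shrinking_funpow[OF shrinking_omega_pow_iter[OF wf shrinking_omega_iterate[OF
      shrinking_halfspace_closed]] halfspace_closed_dual_ball] by blast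
  have "norm \<psi> \<le> 1 - j / n \<Longrightarrow> \<psi> \<in> (?W ^^ j) ?B" for \<psi> j
  proof (induction j arbitrary: \<psi>)
    case 0
    then show ?case by (simp add: dual_ball_def)
  next
    case (Suc j)
    have "\<psi> + c *\<^sub>R point_eval z \<in> ?W ((?W ^^ j) ?B)" if c: "\<bar>c\<bar> = 1 / n" for c
    proof -
      have "\<psi> + c *\<^sub>R point_eval y \<in> (?W ^^ j) ?B" for y
      proof (rule Suc.IH)
        have "norm (\<psi> + c *\<^sub>R point_eval y) \<le> norm \<psi> + \<bar>c\<bar> * norm (point_eval y)"
          by (metis norm_scaleR norm_triangle_ineq)
        also have "\<dots> \<le> (1 - Suc j / n) + 1 / n * 1"
          using c Suc.prems norm_point_eval_le by (intro add_mono mult_mono) auto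
        finally show "norm (\<psi> + c *\<^sub>R point_eval y) \<le> 1 - j / n"
          by (simp add: add_divide_distrib)
      qed
      then show ?thesis
        using point_eval_mem_omega_pow_iter[OF K wf hW[of j], of UNIV \<psi> c z x] z c by simp
    qed
    \<comment> \<open>Both signs of \<open>c\<close> are used: \<open>\<psi>\<close> is the midpoint
      of its two translates.\<close>
    from this[of "1 / n"] this[of "- 1 / n"]
    have "\<psi> + (1 / n) *\<^sub>R point_eval z \<in> (?W ^^ Suc j) ?B" "\<psi> + (- 1 / n) *\<^sub>R point_eval z \<in> (?W ^^ Suc j) ?B"
      by auto
    then have "(1/2) *\<^sub>R ((\<psi> + (1 / n) *\<^sub>R point_eval z) + (\<psi> + (- 1 / n) *\<^sub>R point_eval z)) \<in> (?W ^^ Suc j) ?B"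
      by (rule halfspace_closed_midpoint[OF hW])
    also have "(1/2) *\<^sub>R ((\<psi> + (1 / n) *\<^sub>R point_eval z) + (\<psi> + (- 1 / n) *\<^sub>R point_eval z)) = \<psi>"
      by (simp add: algebra_simps flip: scaleR_add_left)
    finally show ?case .
  qed
  from this[of 0 n] show ?thesis using n by simp
qed

section \<open>The mass of a functional on an open set\<close>

definition supp :: "('a::topological_space \<Rightarrow>\<^sub>C real) \<Rightarrow> 'a set"
  where "supp f = closure {x. f x \<noteq> 0}"

text \<open>For open \<open>U\<close> this is \<open>|\<phi>|(U)\<close> when \<open>\<phi>\<close> is viewed as a measure.\<close>

definition mass :: "(('a::topological_space \<Rightarrow>\<^sub>C real) \<Rightarrow>\<^sub>L real) \<Rightarrow> 'a set \<Rightarrow> real"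
  where "mass \<phi> U = (SUP f\<in>{f. norm f \<le> 1 \<and> supp f \<subseteq> U}. \<phi> f)"

lemma closed_supp [simp]: "closed (supp f)"
  by (simp add: supp_def)

lemma not_in_supp: "x \<notin> supp f \<Longrightarrow> apply_bcontfun f x = 0"
  using closure_subset[of "{x. apply_bcontfun f x \<noteq> 0}"] by (auto simp: supp_def)

lemma supp_subset: "closed S \<Longrightarrow> (\<And>x. x \<notin> S \<Longrightarrow> apply_bcontfun f x = 0) \<Longrightarrow> supp f \<subseteq> S"
  unfolding supp_def by (rule closure_minimal) auto

lemma bcontfun_of_continuous:
  fixes f :: "'a::topological_space \<Rightarrow> real"
  assumes "continuous_on UNIV f" "\<And>x. \<bar>f x\<bar> \<le> b"
  obtains g :: "'a \<Rightarrow>\<^sub>C real" where "\<And>x. g x = f x" "norm g \<le> b"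
proof -
  have "f \<in> bcontfun" using assms by (intro bcontfun_normI) auto
  then obtain g where g: "f = apply_bcontfun g" by (rule bcontfunE)
  then have "norm g \<le> b" using assms(2) by (intro norm_bound) auto
  then show ?thesis using that[of g] g by simp
qed

lemma functional_le_norm: "norm f \<le> 1 \<Longrightarrow> \<bar>blinfun_apply \<phi> f\<bar> \<le> norm \<phi>" for \<phi> :: "'x::real_normed_vector \<Rightarrow>\<^sub>L real"
  using norm_blinfun[of \<phi> f] mult_left_le[of "norm f" "norm \<phi>"] by simp

lemma norm_functional_le:
  fixes \<phi> :: "'x::real_normed_vector \<Rightarrow>\<^sub>L real"
  assumes "\<And>h. norm h \<le> 1 \<Longrightarrow> \<phi> h \<le> b"
  shows "norm \<phi> \<le> b"
proof (rule norm_blinfun_bound)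
  show b: "0 \<le> b" using assms[of 0] by simp
  fix h
  have "\<phi> h \<le> b * norm h" for h
  proof (cases "h = 0")
    case False
    have "norm ((1 / norm h) *\<^sub>R h) \<le> 1" using False by simp
    then have "\<phi> ((1 / norm h) *\<^sub>R h) \<le> b" by (rule assms)
    then show ?thesis using False by (simp add: blinfun.scaleR_right field_simps)
  qed simp
  from this[of h] this[of "- h"] show "norm (\<phi> h) \<le> b * norm h"
    by (simp add: blinfun.minus_right abs_le_iff)
qed

lemma mass_bdd:
  fixes \<phi> :: "('a::topological_space \<Rightarrow>\<^sub>C real) \<Rightarrow>\<^sub>L real"
  shows "bdd_above (blinfun_apply \<phi> ` {f. norm f \<le> 1 \<and> supp f \<subseteq> U})"
proof (rule bdd_aboveI2[where M = "norm \<phi>"])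
  show "\<phi> f \<le> norm \<phi>" if "f \<in> {f. norm f \<le> 1 \<and> supp f \<subseteq> U}" for f
    using functional_le_norm[of f \<phi>] that by simp
qed

lemma mass_upper: "norm f \<le> 1 \<Longrightarrow> supp f \<subseteq> U \<Longrightarrow> blinfun_apply \<phi> f \<le> mass \<phi> U"
  unfolding mass_def by (rule cSUP_upper[OF _ mass_bdd]) simp

lemma supp_zero [simp]: "supp 0 = {}"
  by (simp add: supp_def)

lemma mass_least: "(\<And>f. norm f \<le> 1 \<Longrightarrow> supp f \<subseteq> U \<Longrightarrow> blinfun_apply \<phi> f \<le> c) \<Longrightarrow> mass \<phi> U \<le> c"
  unfolding mass_def by (rule cSUP_least) (auto intro: exI[of _ 0])

lemma mass_approx:
  assumes "c < mass \<phi> U"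
  obtains f where "norm f \<le> 1" "supp f \<subseteq> U" "c < blinfun_apply \<phi> f"
  using assms mass_least[of U \<phi> c] by (meson not_le)

lemma mass_nonneg: "0 \<le> mass \<phi> U"
  using mass_upper[of 0 U \<phi>] by simp

lemma mass_mono: "U \<subseteq> V \<Longrightarrow> mass \<phi> U \<le> mass \<phi> V"
  by (rule mass_least) (auto intro: mass_upper)

lemma mass_le_norm: "mass \<phi> U \<le> norm \<phi>"
  by (rule mass_least) (use functional_le_norm[of _ \<phi>] in fastforce)

lemma mass_empty [simp]: "mass \<phi> {} = 0"
proof (rule antisym)
  show "mass \<phi> {} \<le> 0"
  proof (rule mass_least)
    fix f :: "'a \<Rightarrow>\<^sub>C real" assume "supp f \<subseteq> {}"
    then have "f = 0" using not_in_supp[of _ f] by (intro bcontfun_eqI) auto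
    then show "\<phi> f \<le> 0" by simp
  qed
qed (rule mass_nonneg)

text \<open>Test functions for \<open>U\<close> and for \<open>V\<close> have disjoint supports, so
  their sum still has norm at most 1.\<close>

lemma mass_Un_disjoint:
  assumes "U \<inter> V = {}"
  shows "mass \<phi> U + mass \<phi> V \<le> mass \<phi> (U \<union> V)"
proof -
  have "\<phi> f + \<phi> g \<le> mass \<phi> (U \<union> V)"
    if f: "norm f \<le> 1" "supp f \<subseteq> U" and g: "norm g \<le> 1" "supp g \<subseteq> V" for f g
  proof -
    have "norm (f + g) \<le> 1"
    proof (rule norm_bound)
      fix x
      have "f x = 0 \<or> g x = 0" using assms f(2) g(2) not_in_supp[of x] by blast
      then show "norm ((f + g) x) \<le> 1"
        using abs_apply_le_norm[of f x] abs_apply_le_norm[of g x] f(1) g(1) by auto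
    qed
    moreover have "supp (f + g) \<subseteq> supp f \<union> supp g"
      by (rule supp_subset) (auto simp: not_in_supp)
    ultimately have "\<phi> (f + g) \<le> mass \<phi> (U \<union> V)"
      using f(2) g(2) by (intro mass_upper) auto
    then show ?thesis by (simp add: blinfun.add_right)
  qed
  then have "\<phi> g \<le> mass \<phi> (U \<union> V) - \<phi> f"
    if "norm f \<le> 1" "supp f \<subseteq> U" "norm g \<le> 1" "supp g \<subseteq> V" for f g
    using that by (metis add.commute le_diff_eq)
  then have "mass \<phi> V \<le> mass \<phi> (U \<union> V) - \<phi> f" if "norm f \<le> 1" "supp f \<subseteq> U" for f
    using that by (intro mass_least)
  then have "\<phi> f \<le> mass \<phi> (U \<union> V) - mass \<phi> V" if "norm f \<le> 1" "supp f \<subseteq> U" for f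
    using that by (metis add.commute le_diff_eq)
  then have "mass \<phi> U \<le> mass \<phi> (U \<union> V) - mass \<phi> V"
    by (intro mass_least)
  then show ?thesis by simp
qed

text \<open>A continuous cut-off splits a test function for the union into one for \<open>U\<close>
  and one for \<open>V\<close>.\<close>

lemma mass_Un_le:
  fixes U V :: "'a::t2_space set"
  assumes K: "compact (UNIV :: 'a set)" and "open U" "open V"
  shows "mass \<phi> (U \<union> V) \<le> mass \<phi> U + mass \<phi> V"
proof (rule mass_least)
  fix f :: "'a \<Rightarrow>\<^sub>C real" assume f: "norm f \<le> 1" "supp f \<subseteq> U \<union> V"
  have "closed (supp f - U)" "closed (supp f - V)"
    using assms by (auto intro: closed_Diff)
  moreover have "(supp f - U) \<inter> (supp f - V) = {}" using f(2) by blast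
  ultimately obtain u :: "'a \<Rightarrow>\<^sub>C real" where u: "\<And>x. x \<in> supp f - U \<Longrightarrow> u x = 0" "\<And>x. x \<in> supp f - V \<Longrightarrow> u x = 1"
    by (rule Urysohn_bcontfun[OF K, where a = 0 and b = 1]) auto
  \<comment> \<open>\<open>w\<close> is 0 where \<open>u \<le> 1/3\<close> and 1 where
    \<open>u \<ge> 2/3\<close>. As supports are closures, this margin keeps the support of
    \<open>f1\<close> inside \<open>U\<close> and that of \<open>f2\<close> inside
    \<open>V\<close>.\<close>
  define w where "w x = max 0 (min 1 (3 * u x - 1))" for x
  have w: "0 \<le> w x" "w x \<le> 1" for x by (auto simp: w_def)
  have cont: "continuous_on UNIV w"
    unfolding w_def by (intro continuous_intros) auto
  have le: "\<bar>a * f x\<bar> \<le> 1" if "0 \<le> a" "a \<le> 1" for a x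
    using that abs_apply_le_norm[of f x] f(1) by (simp add: abs_mult mult_le_one)
  obtain f1 :: "'a \<Rightarrow>\<^sub>C real" where f1: "\<And>x. f1 x = w x * f x" "norm f1 \<le> 1"
    by (rule bcontfun_of_continuous[of "\<lambda>x. w x * f x" 1]) (use w le cont in \<open>auto intro!: continuous_intros\<close>)
  obtain f2 :: "'a \<Rightarrow>\<^sub>C real" where f2: "\<And>x. f2 x = (1 - w x) * f x" "norm f2 \<le> 1"
    by (rule bcontfun_of_continuous[of "\<lambda>x. (1 - w x) * f x" 1]) (use w le cont in \<open>auto intro!: continuous_intros\<close>)
  have "supp f1 \<subseteq> supp f \<inter> {x. 1/3 \<le> u x}"
    by (intro supp_subset closed_Int closed_supp closed_Collect_le continuous_intros)
      (auto simp: f1 not_in_supp w_def)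
  then have "supp f1 \<subseteq> U" using u(1) by fastforce
  moreover have "supp f2 \<subseteq> supp f \<inter> {x. u x \<le> 2/3}"
    by (intro supp_subset closed_Int closed_supp closed_Collect_le continuous_intros)
      (auto simp: f2 not_in_supp w_def)
  then have "supp f2 \<subseteq> V" using u(2) by fastforce
  ultimately have "\<phi> f1 + \<phi> f2 \<le> mass \<phi> U + mass \<phi> V"
    using f1(2) f2(2) by (intro add_mono mass_upper)
  moreover have "f = f1 + f2"
    by (rule bcontfun_eqI) (simp add: f1 f2 algebra_simps)
  ultimately show "\<phi> f \<le> mass \<phi> U + mass \<phi> V" by (simp add: blinfun.add_right)
qed

lemma mass_UN_le:
  fixes U :: "'a::t2_space set"
  assumes K: "compact (UNIV :: 'a set)" and "open U" and "finite F" "\<And>z. z \<in> F \<Longrightarrow> open (W z)"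
  shows "mass \<phi> (U \<union> (\<Union>z\<in>F. W z)) \<le> mass \<phi> U + (\<Sum>z\<in>F. mass \<phi> (W z))"
  using assms(3,4)
proof (induction F rule: finite_induct)
  case empty
  then show ?case by simp
next
  case (insert z F)
  have "mass \<phi> (U \<union> (\<Union>z\<in>insert z F. W z)) = mass \<phi> ((U \<union> (\<Union>z\<in>F. W z)) \<union> W z)"
    by (rule arg_cong[of _ _ "mass \<phi>"]) auto
  also have "\<dots> \<le> mass \<phi> (U \<union> (\<Union>z\<in>F. W z)) + mass \<phi> (W z)"
    using insert.prems \<open>open U\<close> by (intro mass_Un_le[OF K]) auto
  finally show ?case using insert by fastforce
qed

lemma mass_UN_disjoint:
  assumes "finite F" "\<And>z. z \<in> F \<Longrightarrow> W z \<inter> U = {}" "disjoint_family_on W F"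
  shows "mass \<phi> U + (\<Sum>z\<in>F. mass \<phi> (W z)) \<le> mass \<phi> (U \<union> (\<Union>z\<in>F. W z))"
  using assms
proof (induction F rule: finite_induct)
  case empty
  then show ?case by simp
next
  case (insert z F)
  have "W z \<inter> W y = {}" if "y \<in> F" for y
    using insert.prems(2) insert.hyps(2) that unfolding disjoint_family_on_def by (metis insertCI)
  then have "(U \<union> (\<Union>z\<in>F. W z)) \<inter> W z = {}" using insert.prems(1) by blast
  then have "mass \<phi> (U \<union> (\<Union>z\<in>F. W z)) + mass \<phi> (W z) \<le> mass \<phi> ((U \<union> (\<Union>z\<in>F. W z)) \<union> W z)"
    by (rule mass_Un_disjoint)
  also have "(U \<union> (\<Union>z\<in>F. W z)) \<union> W z = U \<union> (\<Union>z\<in>insert z F. W z)" by auto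
  finally have "mass \<phi> (U \<union> (\<Union>z\<in>F. W z)) + mass \<phi> (W z) \<le> mass \<phi> (U \<union> (\<Union>z\<in>insert z F. W z))" .
  moreover have "disjoint_family_on W F"
    using insert.prems(2) by (rule disjoint_family_on_mono[rotated]) auto
  then have "mass \<phi> U + (\<Sum>z\<in>F. mass \<phi> (W z)) \<le> mass \<phi> (U \<union> (\<Union>z\<in>F. W z))"
    using insert by auto
  ultimately show ?case using insert.hyps by simp
qed

text \<open>A function vanishing off \<open>U\<close> may have a closed support that leaves
  \<open>U\<close>. Its truncation at height \<open>\<sigma>\<close> is small in norm, and the
  excess is supported where \<open>r\<close> has absolute value at least \<open>\<sigma>\<close>,
  hence in \<open>U\<close>.\<close>

lemma functional_le_mass:
  fixes r :: "'a::topological_space \<Rightarrow>\<^sub>C real"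
  assumes r: "\<And>x. x \<notin> U \<Longrightarrow> r x = 0" and b: "norm r \<le> b"
  shows "blinfun_apply \<phi> r \<le> b * mass \<phi> U"
proof (cases "b = 0")
  case True
  then show ?thesis using b by simp
next
  case False
  then have "0 < b" using b norm_ge_zero[of r] by linarith
  have "\<phi> r \<le> b * mass \<phi> U + \<tau>" if "0 < \<tau>" for \<tau>
  proof -
    define \<sigma> where "\<sigma> = \<tau> / (norm \<phi> + 1)"
    have "0 < norm \<phi> + 1" by (simp add: add_nonneg_pos)
    then have \<sigma>: "0 < \<sigma>" "norm \<phi> * \<sigma> \<le> \<tau>"
      using that by (simp_all add: \<sigma>_def pos_divide_le_eq algebra_simps)
    define clip where "clip x = max (- \<sigma>) (min \<sigma> (r x))" for x
    have cont: "continuous_on UNIV clip"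
      unfolding clip_def by (intro continuous_intros) auto
    obtain r1 :: "'a \<Rightarrow>\<^sub>C real" where r1: "\<And>x. r1 x = clip x" "norm r1 \<le> \<sigma>"
      by (rule bcontfun_of_continuous[OF cont, of \<sigma>]) (use \<sigma> in \<open>auto simp: clip_def\<close>)
    have cont2: "continuous_on UNIV (\<lambda>x. (r x - clip x) / b)"
      using cont False by (intro continuous_on_divide continuous_on_diff) auto
    have le: "\<bar>(r x - clip x) / b\<bar> \<le> 1" for x
      using abs_apply_le_norm[of r x] b \<sigma> \<open>0 < b\<close> by (auto simp: clip_def)
    obtain r2 :: "'a \<Rightarrow>\<^sub>C real" where r2: "\<And>x. r2 x = (r x - clip x) / b" "norm r2 \<le> 1"
      by (rule bcontfun_of_continuous[OF cont2, of 1]) (use le in auto)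
    have "supp r2 \<subseteq> {x. \<sigma> \<le> \<bar>r x\<bar>}"
      by (intro supp_subset closed_Collect_le continuous_intros) (use \<sigma> in \<open>auto simp: r2 clip_def\<close>)
    also have "\<dots> \<subseteq> U"
    proof
      fix x assume "x \<in> {x. \<sigma> \<le> \<bar>r x\<bar>}"
      then have "r x \<noteq> 0" using \<sigma>(1) by auto
      then show "x \<in> U" using r by blast
    qed
    finally have "b * \<phi> r2 \<le> b * mass \<phi> U"
      using r2(2) \<open>0 < b\<close> by (intro mult_left_mono mass_upper) auto
    moreover have "r = r1 + b *\<^sub>R r2"
      using False by (intro bcontfun_eqI) (simp add: r1 r2)
    moreover have "\<phi> r1 \<le> \<tau>"
      using norm_blinfun[of \<phi> r1] mult_left_mono[OF r1(2), of "norm \<phi>"] \<sigma>(2) by simp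
    ultimately show ?thesis
      by (simp add: blinfun.add_right blinfun.scaleR_right)
  qed
  then show ?thesis by (rule field_le_epsilon)
qed

section \<open>Separation of finitely many points\<close>

text \<open>Points are treated one at a time: once the others are separated from
  \<open>insert z S\<close>, a Urysohn function divides the neighbourhood \<open>U\<close> of that
  set between \<open>z\<close> and \<open>S\<close>.\<close>

lemma separate_finite_closed:
  fixes S :: "'a::t2_space set"
  assumes K: "compact (UNIV :: 'a set)"
  shows "finite F \<Longrightarrow> closed S \<Longrightarrow> F \<inter> S = {} \<Longrightarrow>
    \<exists>W U. open U \<and> S \<subseteq> U \<and> (\<forall>z\<in>F. open (W z) \<and> z \<in> W z \<and> W z \<inter> U = {}) \<and> disjoint_family_on W F"
proof (induction F arbitrary: S rule: finite_induct)
  case empty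
  show ?case by (intro exI[of _ "\<lambda>_. {}"] exI[of _ UNIV]) (auto simp: disjoint_family_on_def)
next
  case (insert z F)
  have "closed (insert z S)" "F \<inter> insert z S = {}" using insert by auto
  from insert.IH[OF this] obtain W U where WU: "open U" "insert z S \<subseteq> U"
      "\<And>y. y \<in> F \<Longrightarrow> open (W y) \<and> y \<in> W y \<and> W y \<inter> U = {}" "disjoint_family_on W F"
    by blast
  obtain u :: "'a \<Rightarrow>\<^sub>C real" where u: "\<And>x. x \<in> {z} \<Longrightarrow> u x = 0" "\<And>x. x \<in> S \<Longrightarrow> u x = 1"
    by (rule Urysohn_bcontfun[OF K, where S = "{z}" and T = S and a = 0 and b = 1]) (use insert.prems in auto)
  define A where "A = U \<inter> {x. u x < 1/2}"
  define B where "B = U \<inter> {x. 1/2 < u x}"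
  have "open A" "open B"
    unfolding A_def B_def using WU(1) by (auto intro!: open_Int open_Collect_less continuous_intros)
  moreover have "z \<in> A" and "S \<subseteq> B" and "A \<inter> B = {}" and "A \<subseteq> U" and "B \<subseteq> U"
    using WU(2) u by (auto simp: A_def B_def)
  moreover have "W y \<inter> B = {}" if "y \<in> F" for y using WU(3)[OF that] \<open>B \<subseteq> U\<close> by blast
  ultimately have "\<forall>y\<in>insert z F. open ((W(z := A)) y) \<and> y \<in> (W(z := A)) y \<and> (W(z := A)) y \<inter> B = {}"
    using WU(3) insert.hyps(2) by simp
  moreover have "disjoint_family_on (W(z := A)) (insert z F)"
    using WU(3,4) \<open>A \<subseteq> U\<close> insert.hyps(2) unfolding disjoint_family_on_def by auto blast+
  ultimately show ?case using \<open>open B\<close> \<open>S \<subseteq> B\<close> by blast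
qed

text \<open>The bumps live on disjoint neighbourhoods, so at most one of them is nonzero at each
  point.\<close>

lemma partial_partition_of_unity:
  fixes F :: "'a::t2_space set"
  assumes K: "compact (UNIV :: 'a set)" and F: "finite F"
  obtains f :: "'a \<Rightarrow> 'a \<Rightarrow>\<^sub>C real"
  where "\<And>z x. z \<in> F \<Longrightarrow> 0 \<le> f z x" "\<And>x. (\<Sum>z\<in>F. f z x) \<le> 1" "\<And>z. z \<in> F \<Longrightarrow> f z z = 1"
proof -
  obtain W where W: "\<And>z. z \<in> F \<Longrightarrow> open (W z) \<and> z \<in> W z" "disjoint_family_on W F"
    using separate_finite_closed[OF K F, of "{}"] by auto
  have "\<exists>g :: 'a \<Rightarrow>\<^sub>C real. (\<forall>x. 0 \<le> g x \<and> g x \<le> 1) \<and> g z = 1 \<and> (\<forall>x. x \<notin> W z \<longrightarrow> g x = 0)" if "z \<in> F" for z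
  proof -
    have "closed (- W z)" "closed {z}" "- W z \<inter> {z} = {}" using W(1)[OF that] by auto
    then obtain g :: "'a \<Rightarrow>\<^sub>C real" where "\<And>x. 0 \<le> g x" "\<And>x. g x \<le> 1" "\<And>x. x \<in> - W z \<Longrightarrow> g x = 0"
        "\<And>x. x \<in> {z} \<Longrightarrow> g x = 1"
      by (rule Urysohn_bcontfun[OF K, where a = 0 and b = 1]) auto
    then show ?thesis by (intro exI[of _ g]) auto
  qed
  then obtain f :: "'a \<Rightarrow> 'a \<Rightarrow>\<^sub>C real" where f: "\<And>z x. z \<in> F \<Longrightarrow> 0 \<le> f z x \<and> f z x \<le> 1"
      "\<And>z. z \<in> F \<Longrightarrow> f z z = 1" "\<And>z x. z \<in> F \<Longrightarrow> x \<notin> W z \<Longrightarrow> f z x = 0"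
    by metis
  have "(\<Sum>z\<in>F. f z x) \<le> 1" for x
  proof (cases "\<exists>z\<in>F. x \<in> W z")
    case True
    then obtain z where z: "z \<in> F" "x \<in> W z" by blast
    have "f y x = 0" if "y \<in> F - {z}" for y
      using W(2) z that f(3)[of y x] unfolding disjoint_family_on_def by blast
    then have "(\<Sum>z\<in>F. f z x) = f z x"
      using F z(1) by (simp add: sum.remove)
    then show ?thesis using f(1)[OF z(1)] by simp
  next
    case False
    then show ?thesis using f(3) by simp
  qed
  then show ?thesis using f(1,2) that by blast
qed

section \<open>Upper bound\<close>

text \<open>As long as the bound on the potential is well above \<open>m\<close>, each application
  of \<open>D\<close> lowers it by \<open>\<delta>\<close>, so finitely many reach \<open>m\<close>.
  The step is assumed for all subsets of \<open>L\<close>, hence applies at every stage.\<close>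

lemma funpow_potential_drop:
  fixes \<Phi> :: "'b \<Rightarrow> real"
  assumes D: "\<And>S. D S \<subseteq> S" and \<delta>: "0 < \<delta>" and c0: "\<And>\<psi>. \<psi> \<in> L \<Longrightarrow> \<Phi> \<psi> \<le> c0"
    and step: "\<And>L' c \<psi>. L' \<subseteq> L \<Longrightarrow> (\<And>\<psi>. \<psi> \<in> L' \<Longrightarrow> \<Phi> \<psi> \<le> c) \<Longrightarrow> \<psi> \<in> D L' \<Longrightarrow> \<Phi> \<psi> \<le> max (c - \<delta>) m"
  shows "\<exists>k. \<forall>\<psi>\<in>(D ^^ k) L. \<Phi> \<psi> \<le> m"
proof -
  have "(D ^^ k) L \<subseteq> L \<and> (\<forall>\<psi>\<in>(D ^^ k) L. \<Phi> \<psi> \<le> max (c0 - real k * \<delta>) m)" for k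
  proof (induction k)
    case 0
    then show ?case using c0 by (simp add: le_max_iff_disj)
  next
    case (Suc k)
    have "\<Phi> \<psi> \<le> max (max (c0 - real k * \<delta>) m - \<delta>) m" if "\<psi> \<in> D ((D ^^ k) L)" for \<psi>
      using Suc that by (intro step) auto
    moreover have "max (max (c0 - real k * \<delta>) m - \<delta>) m = max (c0 - real (Suc k) * \<delta>) m"
      using \<delta> by (auto simp: algebra_simps max_def)
    ultimately show ?case using D[of "(D ^^ k) L"] Suc by auto
  qed
  moreover obtain k where "c0 - m < real k * \<delta>"
    using \<delta> ex_less_of_nat_mult by blast
  then have "max (c0 - real k * \<delta>) m = m" by simp
  ultimately show ?thesis by metis
qed

text \<open>A test function \<open>h\<close> is replaced by the interpolant \<open>s\<close> of its
  values on \<open>F\<close>. The remainder has norm at most 2 and vanishes on \<open>F\<close>, so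
  it costs at most \<open>2 * e\<close> for each functional.\<close>

lemma norm_diff_le_finite:
  fixes F :: "'a::t2_space set" and f :: "'a \<Rightarrow> 'a \<Rightarrow>\<^sub>C real" and \<psi>1 \<psi>2 :: "('a \<Rightarrow>\<^sub>C real) \<Rightarrow>\<^sub>L real"
  assumes F: "finite F" and f: "\<And>z x. z \<in> F \<Longrightarrow> 0 \<le> f z x" "\<And>x. (\<Sum>z\<in>F. f z x) \<le> 1"
      "\<And>z. z \<in> F \<Longrightarrow> f z z = 1"
    and e: "mass \<psi>1 (- F) \<le> e" "mass \<psi>2 (- F) \<le> e"
  shows "norm (\<psi>1 - \<psi>2) \<le> (\<Sum>z\<in>F. \<bar>(\<psi>1 - \<psi>2) (f z)\<bar>) + 4 * e"
proof (rule norm_functional_le)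
  fix h :: "'a \<Rightarrow>\<^sub>C real" assume h: "norm h \<le> 1"
  define s where "s = (\<Sum>z\<in>F. h z *\<^sub>R f z)"
  have s_apply: "s x = (\<Sum>z\<in>F. h z * f z x)" for x
    unfolding s_def using F by (induction F rule: finite_induct) auto
  have le1: "\<bar>h x\<bar> \<le> 1" for x using abs_apply_le_norm[of h x] h by linarith
  have "\<bar>s x\<bar> \<le> 1" for x
  proof -
    have "\<bar>s x\<bar> \<le> (\<Sum>z\<in>F. \<bar>h z * f z x\<bar>)" unfolding s_apply by (rule sum_abs)
    also have "\<dots> \<le> (\<Sum>z\<in>F. f z x)"
      using f(1) le1 by (intro sum_mono) (simp add: abs_mult mult_left_le_one_le)
    finally show ?thesis using f(2)[of x] by linarith
  qed
  then have "\<bar>h x - s x\<bar> \<le> 2" for x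
    using le1[of x] abs_triangle_ineq4[of "h x" "s x"] by (metis add_mono one_add_one order_trans)
  then have norm: "norm (h - s) \<le> 2" by (intro norm_bound) simp
  have zero: "(h - s) x = 0" if "x \<notin> - F" for x
  proof -
    have x: "x \<in> F" using that by simp
    \<comment> \<open>As \<open>f x x = 1\<close> exhausts the bound on the sum, the other bumps
      vanish at \<open>x\<close> and \<open>s\<close> agrees with \<open>h\<close> there.\<close>
    have "(\<Sum>z\<in>F - {x}. f z x) \<le> 0"
      using f(2)[of x] f(3)[OF x] F x by (simp add: sum.remove)
    then have "(\<Sum>z\<in>F - {x}. f z x) = 0"
      using f(1) by (intro antisym sum_nonneg) auto
    then have "\<forall>z\<in>F - {x}. f z x = 0"
      using f(1) F by (subst (asm) sum_nonneg_eq_0_iff) auto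
    then have "(\<Sum>z\<in>F - {x}. h z * f z x) = 0" by (intro sum.neutral) auto
    then have "s x = h x"
      unfolding s_apply using F x f(3)[OF x] by (simp add: sum.remove[of F x])
    then show ?thesis by simp
  qed
  have "\<psi>1 (h - s) \<le> 2 * mass \<psi>1 (- F)" "\<psi>2 (s - h) \<le> 2 * mass \<psi>2 (- F)"
    using zero norm by (auto intro!: functional_le_mass simp: norm_minus_commute)
  moreover have "(\<psi>1 - \<psi>2) s \<le> (\<Sum>z\<in>F. \<bar>(\<psi>1 - \<psi>2) (f z)\<bar>)"
  proof -
    have "(\<psi>1 - \<psi>2) s = (\<Sum>z\<in>F. h z * (\<psi>1 - \<psi>2) (f z))"
      unfolding s_def by (simp add: blinfun.sum_right blinfun.scaleR_right)
    also have "\<dots> \<le> (\<Sum>z\<in>F. \<bar>(\<psi>1 - \<psi>2) (f z)\<bar>)"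
    proof (rule sum_mono)
      fix z
      have "h z * (\<psi>1 - \<psi>2) (f z) \<le> \<bar>h z\<bar> * \<bar>(\<psi>1 - \<psi>2) (f z)\<bar>"
        by (metis abs_ge_self abs_mult)
      also have "\<dots> \<le> \<bar>(\<psi>1 - \<psi>2) (f z)\<bar>" using le1 by (simp add: mult_left_le_one_le)
      finally show "h z * (\<psi>1 - \<psi>2) (f z) \<le> \<bar>(\<psi>1 - \<psi>2) (f z)\<bar>" .
    qed
    finally show ?thesis .
  qed
  ultimately show "(\<psi>1 - \<psi>2) h \<le> (\<Sum>z\<in>F. \<bar>(\<psi>1 - \<psi>2) (f z)\<bar>) + 4 * e"
    using e by (simp add: blinfun.diff_left blinfun.diff_right)
qed

text \<open>Up to a small error a functional is described by the finitely many numbers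
  \<open>\<psi> (f z)\<close>. The sum of their squares is strictly convex in them, so where the
  potential is nearly maximal its derivative gives a slice on which they hardly vary. The multiple
  of \<open>\<psi> x\<close> keeps that slice inside \<open>t < \<psi> x\<close>.\<close>

lemma finite_mass_drop:
  fixes F :: "'a::t2_space set" and L :: "(('a \<Rightarrow>\<^sub>C real) \<Rightarrow>\<^sub>L real) set"
  assumes K: "compact (UNIV :: 'a set)" and F: "finite F" and \<epsilon>: "0 < \<epsilon>" and e: "e < \<epsilon> / 8"
    and t: "t < t'" and L: "L \<subseteq> dual_ball" and mass: "\<And>\<psi>. \<psi> \<in> L \<Longrightarrow> t < blinfun_apply \<psi> x \<Longrightarrow> mass \<psi> (- F) \<le> e"
  shows "\<exists>k. \<forall>\<psi>\<in>(dz_deriv \<epsilon> ^^ k) L. \<psi> x \<le> t'"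
proof -
  obtain f :: "'a \<Rightarrow> 'a \<Rightarrow>\<^sub>C real" where f: "\<And>z x. z \<in> F \<Longrightarrow> 0 \<le> f z x" "\<And>x. (\<Sum>z\<in>F. f z x) \<le> 1"
      "\<And>z. z \<in> F \<Longrightarrow> f z z = 1"
    using partial_partition_of_unity[OF K F] by blast
  define n where "n = real (card F)"
  \<comment> \<open>The sum of squares is at most \<open>n\<close>, so
    \<open>\<Phi> \<psi> > M * t' - 1\<close> forces \<open>\<psi> x > t\<close>; the extra 1
    absorbs \<open>\<delta>\<close>.\<close>
  define M where "M = (n + 1) / (t' - t)"
  \<comment> \<open>The variation over \<open>F\<close> will be at most
    \<open>2 * n * \<rho> < \<epsilon> / 2\<close>, and the mass off \<open>F\<close> contributes
    \<open>4 * e < \<epsilon> / 2\<close>.\<close>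
  define \<rho> where "\<rho> = min 1 (\<epsilon> / (4 * (n + 1)))"
  define \<delta> where "\<delta> = \<rho>\<^sup>2 / 2"
  define \<Phi> where "\<Phi> \<psi> = M * \<psi> x + (\<Sum>z\<in>F. (\<psi> (f z))\<^sup>2)" for \<psi> :: "('a \<Rightarrow>\<^sub>C real) \<Rightarrow>\<^sub>L real"
  have n: "0 \<le> n" by (simp add: n_def)
  have M: "0 < M" "M * t' = M * t + n + 1"
    using t n by (auto simp: M_def field_simps)
  have \<rho>: "0 < \<rho>" "\<rho> \<le> 1" using \<epsilon> n by (auto simp: \<rho>_def)
  have \<rho>n: "2 * n * \<rho> < \<epsilon> / 2"
  proof -
    have "2 * n * \<rho> \<le> 2 * n * (\<epsilon> / (4 * (n + 1)))" using n by (intro mult_left_mono) (auto simp: \<rho>_def)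
    also have "\<dots> < \<epsilon> / 2" using n \<epsilon> by (simp add: field_simps)
    finally show ?thesis .
  qed
  have \<delta>: "0 < \<delta>" "\<delta> \<le> 1" using \<rho> power_le_one[of \<rho> 2] by (auto simp: \<delta>_def)
  have sq: "0 \<le> (\<Sum>z\<in>F. (\<psi> (f z))\<^sup>2) \<and> (\<Sum>z\<in>F. (\<psi> (f z))\<^sup>2) \<le> n" if "\<psi> \<in> L" for \<psi>
  proof -
    have "(\<psi> (f z))\<^sup>2 \<le> 1" if z: "z \<in> F" for z
    proof -
      have "norm (f z) \<le> 1"
      proof (rule norm_bound)
        fix x
        have "f z x \<le> (\<Sum>z\<in>F. f z x)" using z F f(1) by (intro member_le_sum) auto
        then show "norm (f z x) \<le> 1" using f(1)[OF z, of x] f(2)[of x] by simp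
      qed
      then have "\<bar>\<psi> (f z)\<bar> \<le> 1"
        using functional_le_norm[of "f z" \<psi>] L \<open>\<psi> \<in> L\<close> by (auto simp: dual_ball_def)
      then show ?thesis by (simp add: abs_square_le_1)
    qed
    then have "(\<Sum>z\<in>F. (\<psi> (f z))\<^sup>2) \<le> (\<Sum>z\<in>F. 1)" by (rule sum_mono)
    then show ?thesis by (simp add: n_def sum_nonneg)
  qed
  have "\<exists>k. \<forall>\<psi>\<in>(dz_deriv \<epsilon> ^^ k) L. \<Phi> \<psi> \<le> M * t'"
  proof (rule funpow_potential_drop[OF dz_deriv_subset \<delta>(1)])
    fix \<psi> assume \<psi>: "\<psi> \<in> L"
    have "\<bar>\<psi> x\<bar> \<le> 1 * norm x"
      using norm_blinfun[of \<psi> x] mult_right_mono[of "norm \<psi>" 1 "norm x"] L \<psi> by (auto simp: dual_ball_def)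
    then have "M * \<psi> x \<le> M * norm x" using M(1) by (intro mult_left_mono) auto
    then show "\<Phi> \<psi> \<le> M * norm x + n" using sq[OF \<psi>] by (simp add: \<Phi>_def)
  next
    fix L' c \<phi>
    assume L': "L' \<subseteq> L" and c: "\<And>\<psi>. \<psi> \<in> L' \<Longrightarrow> \<Phi> \<psi> \<le> c" and \<phi>: "\<phi> \<in> dz_deriv \<epsilon> L'"
    show "\<Phi> \<phi> \<le> max (c - \<delta>) (M * t')"
    proof (rule ccontr)
      assume "\<not> \<Phi> \<phi> \<le> max (c - \<delta>) (M * t')"
      then have big: "c - \<delta> < \<Phi> \<phi>" "M * t' < \<Phi> \<phi>" by auto
      txt \<open>\<open>y\<close> is the derivative of \<open>\<Phi>\<close> at \<open>\<phi>\<close>.\<close>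
      define y where "y = M *\<^sub>R x + (\<Sum>z\<in>F. (2 * \<phi> (f z)) *\<^sub>R f z)"
      let ?S = "wslice y (\<phi> y - \<delta>) L'"
      have y: "\<Phi> \<psi> = \<Phi> \<phi> + (\<psi> - \<phi>) y + (\<Sum>z\<in>F. ((\<psi> - \<phi>) (f z))\<^sup>2)" for \<psi>
        unfolding \<Phi>_def y_def
        by (simp add: blinfun.add_right blinfun.sum_right blinfun.scaleR_right blinfun.diff_left
            power2_diff sum.distrib sum_subtractf sum_distrib_left algebra_simps power2_eq_square)
      have near: "mass \<psi> (- F) \<le> e \<and> (\<forall>z\<in>F. \<bar>(\<psi> - \<phi>) (f z)\<bar> \<le> \<rho>)" if "\<psi> \<in> ?S" for \<psi>
      proof -
        have \<psi>: "\<psi> \<in> L'" "- \<delta> < (\<psi> - \<phi>) y" using that by (auto simp: wslice_def blinfun.diff_left)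
        have nonneg: "0 \<le> (\<Sum>z\<in>F. ((\<psi> - \<phi>) (f z))\<^sup>2)" by (simp add: sum_nonneg)
        have "\<Phi> \<phi> - \<delta> < \<Phi> \<psi>" using y[of \<psi>] \<psi>(2) nonneg by linarith
        moreover have "\<Phi> \<psi> \<le> M * \<psi> x + n" using sq[of \<psi>] \<psi>(1) L' by (auto simp: \<Phi>_def)
        ultimately have "M * t < M * \<psi> x" using big(2) M(2) \<delta>(2) by linarith
        then have "mass \<psi> (- F) \<le> e" using M(1) mass \<psi>(1) L' by auto
        moreover have "\<bar>(\<psi> - \<phi>) (f z)\<bar> \<le> \<rho>" if z: "z \<in> F" for z
        proof -
          have "((\<psi> - \<phi>) (f z))\<^sup>2 \<le> (\<Sum>z\<in>F. ((\<psi> - \<phi>) (f z))\<^sup>2)"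
            using F z by (intro member_le_sum) auto
          \<comment> \<open>On \<open>L'\<close> the potential exceeds \<open>\<Phi> \<phi>\<close>
            by less than \<open>\<delta>\<close>, and on the slice the linear term loses less than
            \<open>\<delta>\<close>; the quadratic term is bounded by the sum of the two.\<close>
          also have "\<dots> \<le> 2 * \<delta>" using y[of \<psi>] \<psi>(2) c[OF \<psi>(1)] big(1) by linarith
          finally show ?thesis using \<rho>(1) abs_le_square_iff[of "(\<psi> - \<phi>) (f z)" \<rho>] by (simp add: \<delta>_def)
        qed
        ultimately show ?thesis by blast
      qed
      have \<phi>S: "\<phi> \<in> ?S" using \<phi> \<delta>(1) dz_deriv_subset[of \<epsilon> L'] by (auto simp: wslice_def)
      have "diameter ?S \<le> 2 * n * \<rho> + 4 * e"
      proof (rule diameter_le)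
        show "?S \<noteq> {} \<or> 0 \<le> 2 * n * \<rho> + 4 * e" using \<phi>S by blast
        fix \<psi>1 \<psi>2 assume S: "\<psi>1 \<in> ?S" "\<psi>2 \<in> ?S"
        have "\<bar>(\<psi>1 - \<psi>2) (f z)\<bar> \<le> 2 * \<rho>" if "z \<in> F" for z
          using near[OF S(1)] near[OF S(2)] that by (force simp: blinfun.diff_left abs_le_iff)
        then have "(\<Sum>z\<in>F. \<bar>(\<psi>1 - \<psi>2) (f z)\<bar>) \<le> (\<Sum>z\<in>F. 2 * \<rho>)" by (rule sum_mono)
        also have "\<dots> = 2 * n * \<rho>" by (simp add: n_def)
        finally show "norm (\<psi>1 - \<psi>2) \<le> 2 * n * \<rho> + 4 * e"
          using norm_diff_le_finite[OF F f, of \<psi>1 e \<psi>2] near[OF S(1)] near[OF S(2)] by linarith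
      qed
      also have "\<dots> < \<epsilon>" using \<rho>n e by simp
      finally have "diameter ?S < \<epsilon>" .
      moreover have "\<epsilon> \<le> diameter ?S"
        using \<phi> \<delta>(1) unfolding dz_deriv_mem_iff by simp
      ultimately show False by simp
    qed
  qed
  then obtain k where k: "\<And>\<psi>. \<psi> \<in> (dz_deriv \<epsilon> ^^ k) L \<Longrightarrow> \<Phi> \<psi> \<le> M * t'" by blast
  have "(dz_deriv \<epsilon> ^^ k) L \<subseteq> L"
    by (induction k) (use dz_deriv_subset in auto)
  then have "M * \<psi> x \<le> M * t'" if "\<psi> \<in> (dz_deriv \<epsilon> ^^ k) L" for \<psi>
    using k[OF that] sq[of \<psi>] that unfolding \<Phi>_def by fastforce
  then show ?thesis using M(1) by auto
qed

lemma sum_list_sum_swap: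
  fixes f :: "'c \<Rightarrow> 'b \<Rightarrow> real"
  assumes "finite F"
  shows "(\<Sum>C\<leftarrow>Cs. \<Sum>z\<in>F. f C z) = (\<Sum>z\<in>F. \<Sum>C\<leftarrow>Cs. f C z)"
  by (induction Cs) (simp_all add: sum.distrib)

lemma derived_set_closed_subset: "closed C \<Longrightarrow> derived_set C \<subseteq> C"
  by (auto simp: derived_set_def closed_limpt)

text \<open>The support of \<open>g C\<close> meets \<open>C\<close> only in isolated points of
  \<open>C\<close>, hence in a finite set by compactness. So \<open>\<psi> (g C)\<close> is paid for
  by the outside of \<open>C\<close> and by small disjoint neighbourhoods of these points. By
  \<open>count\<close>, summing over the list charges each neighbourhood at most once.\<close>

lemma mass_compl_finite_le:
  fixes Cs :: "'a::t2_space set list" and g :: "'a set \<Rightarrow> 'a \<Rightarrow>\<^sub>C real"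
    and \<psi> :: "('a \<Rightarrow>\<^sub>C real) \<Rightarrow>\<^sub>L real"
  assumes K: "compact (UNIV :: 'a set)" and closed: "\<And>C. C \<in> set Cs \<Longrightarrow> closed C"
    and count: "\<And>z. (\<Sum>C\<leftarrow>Cs. of_bool (z \<in> C) - of_bool (z \<in> derived_set C)) \<le> (1::real)"
    and g: "\<And>C. C \<in> set Cs \<Longrightarrow> norm (g C) \<le> 1" "\<And>C. C \<in> set Cs \<Longrightarrow> supp (g C) \<subseteq> - derived_set C"
  defines "F \<equiv> \<Union>C\<in>set Cs. supp (g C) \<inter> C"
  shows "finite F" and "mass \<psi> (- F) \<le> mass \<psi> UNIV - (\<Sum>C\<leftarrow>Cs. \<psi> (g C) - mass \<psi> (- C))"
proof -
  have "finite (supp (g C) \<inter> C)" if C: "C \<in> set Cs" for C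
  proof (rule ccontr)
    assume inf: "infinite (supp (g C) \<inter> C)"
    have "compact (supp (g C) \<inter> C)"
      using K closed[OF C] by (metis closed_Int closed_supp compact_Int_closed inf_top_left)
    then obtain x where x: "x \<in> supp (g C) \<inter> C" "x islimpt (supp (g C) \<inter> C)"
      using Heine_Borel_imp_Bolzano_Weierstrass[OF _ inf subset_refl] by blast
    then have "x \<in> derived_set C"
      unfolding derived_set_def using islimpt_subset by blast
    then show False using g(2)[OF C] x(1) by blast
  qed
  then show F: "finite F" by (simp add: F_def)
  show "mass \<psi> (- F) \<le> mass \<psi> UNIV - (\<Sum>C\<leftarrow>Cs. \<psi> (g C) - mass \<psi> (- C))"
  proof (rule mass_least)
    fix h :: "'a \<Rightarrow>\<^sub>C real" assume h: "norm h \<le> 1" "supp h \<subseteq> - F"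
    have "F \<inter> supp h = {}" using h(2) by blast
    then obtain W U where WU: "open U" "supp h \<subseteq> U"
        "\<And>z. z \<in> F \<Longrightarrow> open (W z) \<and> z \<in> W z \<and> W z \<inter> U = {}" "disjoint_family_on W F"
      using separate_finite_closed[OF K F closed_supp[of h]] by blast
    have "\<psi> h + (\<Sum>z\<in>F. mass \<psi> (W z)) \<le> mass \<psi> U + (\<Sum>z\<in>F. mass \<psi> (W z))"
      using h(1) WU(2) mass_upper by simp
    also have "\<dots> \<le> mass \<psi> (U \<union> (\<Union>z\<in>F. W z))"
      using WU(3,4) F by (intro mass_UN_disjoint) auto
    also have "\<dots> \<le> mass \<psi> UNIV" by (rule mass_mono) simp
    finally have 1: "\<psi> h + (\<Sum>z\<in>F. mass \<psi> (W z)) \<le> mass \<psi> UNIV" .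
    have "\<psi> (g C) - mass \<psi> (- C) \<le> (\<Sum>z\<in>F. (of_bool (z \<in> C) - of_bool (z \<in> derived_set C)) * mass \<psi> (W z))"
      if C: "C \<in> set Cs" for C
    proof -
      let ?FC = "supp (g C) \<inter> C"
      have FC: "?FC \<subseteq> F" using C by (auto simp: F_def)
      then have fin: "finite ?FC" using F finite_subset by blast
      have "\<psi> (g C) \<le> mass \<psi> (- C \<union> (\<Union>z\<in>?FC. W z))"
        using g(1)[OF C] FC WU(3) by (intro mass_upper) auto
      also have "\<dots> \<le> mass \<psi> (- C) + (\<Sum>z\<in>?FC. mass \<psi> (W z))"
        using closed[OF C] FC WU(3) fin by (intro mass_UN_le[OF K]) auto
      also have "(\<Sum>z\<in>?FC. mass \<psi> (W z)) =
          (\<Sum>z\<in>?FC. (of_bool (z \<in> C) - of_bool (z \<in> derived_set C)) * mass \<psi> (W z))"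
        using g(2)[OF C] by (intro sum.cong) auto
      also have "\<dots> \<le> (\<Sum>z\<in>F. (of_bool (z \<in> C) - of_bool (z \<in> derived_set C)) * mass \<psi> (W z))"
        using F FC derived_set_closed_subset[OF closed[OF C]] mass_nonneg[of \<psi>]
        by (intro sum_mono2) auto
      finally show ?thesis by simp
    qed
    then have "(\<Sum>C\<leftarrow>Cs. \<psi> (g C) - mass \<psi> (- C)) \<le>
        (\<Sum>C\<leftarrow>Cs. \<Sum>z\<in>F. (of_bool (z \<in> C) - of_bool (z \<in> derived_set C)) * mass \<psi> (W z))"
      by (rule sum_list_mono)
    also have "\<dots> = (\<Sum>z\<in>F. (\<Sum>C\<leftarrow>Cs. of_bool (z \<in> C) - of_bool (z \<in> derived_set C)) * mass \<psi> (W z))"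
      unfolding sum_list_sum_swap[OF F] by (simp add: sum_list_mult_const)
    also have "\<dots> \<le> (\<Sum>z\<in>F. 1 * mass \<psi> (W z))"
      using count mass_nonneg by (intro sum_mono mult_right_mono)
    finally show "\<psi> h \<le> mass \<psi> UNIV - (\<Sum>C\<leftarrow>Cs. \<psi> (g C) - mass \<psi> (- C))"
      using 1 by simp
  qed
qed

text \<open>In a Hausdorff space every neighbourhood of an accumulation point contains infinitely
  many points of the set, a property that passes to limits of accumulation points.\<close>

lemma shrinking_derived_set: "shrinking closed (derived_set :: 'a::t2_space set \<Rightarrow> 'a set)"
  unfolding shrinking_def
proof (intro conjI allI impI derived_set_closed_subset)
  show "closed (derived_set S)" for S :: "'a set"
    unfolding closed_limpt
  proof (intro allI impI)
    fix x assume x: "x islimpt derived_set S"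
    have "infinite (U \<inter> S)" if "open U" "x \<in> U" for U
    proof -
      obtain y where "y \<in> derived_set S" "y \<in> U"
        using x \<open>open U\<close> \<open>x \<in> U\<close> unfolding islimpt_def by blast
      then show ?thesis
        using \<open>open U\<close> by (simp add: derived_set_def islimpt_eq_acc_point)
    qed
    then show "x \<in> derived_set S" by (simp add: derived_set_def islimpt_eq_acc_point)
  qed
qed auto

lemma shrinking_dz_omega: "shrinking (\<lambda>_. True) (dz_omega \<epsilon>)"
  using shrinking_omega_iterate[of "\<lambda>_. True" "dz_deriv \<epsilon>"] dz_deriv_subset
  by (auto simp: shrinking_def)

section \<open>Compactness for iterated derived sets\<close>

text \<open>Two stages have a common later one: if \<open>b\<close> is below \<open>c\<close>, a
  single step at exponent \<open>c\<close> passes all multiples at exponent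
  \<open>b\<close>.\<close>

lemma omega_pow_iter_directed:
  assumes wo: "Well_order r" and f: "shrinking P f" and ne: "underS r x \<noteq> {}"
  shows "finite I \<Longrightarrow> I \<subseteq> underS r x \<times> UNIV \<Longrightarrow> \<exists>b\<in>underS r x. \<exists>m. \<forall>(b', m')\<in>I. \<forall>X. P X \<longrightarrow>
    (omega_pow_iter r f b ^^ m) X \<subseteq> (omega_pow_iter r f b' ^^ m') X"
proof (induction I rule: finite_induct)
  case empty
  then show ?case using ne by blast
next
  case (insert p I)
  let ?J = "omega_pow_iter r f"
  note wf = Well_order_props(1)[OF wo]
  note anti = funpow_shrinking_antimono[OF shrinking_omega_pow_iter[OF wf f]]
  \<comment> \<open>\<open>max 1 n\<close> ensures at least one step at the larger exponent, even
    for \<open>n = 0\<close>.\<close>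
  have up: "(?J c ^^ max 1 n) X \<subseteq> (?J b ^^ m) X" if "b \<in> underS r c" "P X" for b c m n X
    using omega_pow_iter_subset[OF wf that(1), of f X m] anti[OF that(2), of 1 "max 1 n" c] by simp
  obtain b m where b: "b \<in> underS r x"
      and IH: "\<And>b' m' X. (b', m') \<in> I \<Longrightarrow> P X \<Longrightarrow> (?J b ^^ m) X \<subseteq> (?J b' ^^ m') X"
    using insert.IH insert.prems by blast
  obtain c n where p: "p = (c, n)" "c \<in> underS r x" using insert.prems by auto
  have "\<exists>b'\<in>underS r x. \<exists>m'. \<forall>X. P X \<longrightarrow> (?J b' ^^ m') X \<subseteq> (?J b ^^ m) X \<and> (?J b' ^^ m') X \<subseteq> (?J c ^^ n) X"
  proof -
    consider "c = b" | "b \<in> underS r c" | "c \<in> underS r b"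
      using Well_order_cases[OF wo underS_in_Field[OF wo b] underS_in_Field[OF wo p(2)]] by metis
    then show ?thesis
    proof cases
      case 1
      then show ?thesis
        using b anti[of _ m "max m n" b] anti[of _ n "max m n" b]
        by (intro bexI[of _ b] exI[of _ "max m n"]) auto
    next
      case 2
      then show ?thesis
        using p(2) up[of b c] anti[of _ n "max 1 n" c] by (intro bexI[of _ c] exI[of _ "max 1 n"]) auto
    next
      case 3
      then show ?thesis
        using b up[of c b] anti[of _ m "max 1 m" b] by (intro bexI[of _ b] exI[of _ "max 1 m"]) auto
    qed
  qed
  then obtain b' m' where b': "b' \<in> underS r x"
      "\<And>X. P X \<Longrightarrow> (?J b' ^^ m') X \<subseteq> (?J b ^^ m) X \<and> (?J b' ^^ m') X \<subseteq> (?J c ^^ n) X"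
    by blast
  have "(?J b' ^^ m') X \<subseteq> (?J d ^^ k) X" if "(d, k) \<in> insert p I" "P X" for d k X
    using that(1) p(1) IH[of d k X] b'(2)[OF that(2)] that(2) by auto
  then show ?case using b'(1) by blast
qed

text \<open>The stages omega^b m form a directed family of closed sets. If the intersection misses a
  compact set, one member does, and directedness yields one stage for the whole finite
  family.\<close>

lemma omega_pow_iter_derived_compact:
  fixes \<C> :: "'a::t2_space set set"
  assumes K: "compact (UNIV :: 'a set)" and wo: "Well_order r" and ne: "underS r x \<noteq> {}"
    and fin: "finite \<C>" and C: "\<And>C. C \<in> \<C> \<Longrightarrow> closed C" and S: "\<And>C. C \<in> \<C> \<Longrightarrow> closed (S C)"
    and disj: "\<And>C. C \<in> \<C> \<Longrightarrow> S C \<inter> omega_pow_iter r derived_set x C = {}"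
  shows "\<exists>b\<in>underS r x. \<exists>m. \<forall>C\<in>\<C>. S C \<inter> (omega_pow_iter r derived_set b ^^ m) C = {}"
proof -
  let ?J = "omega_pow_iter r (derived_set :: 'a set \<Rightarrow> 'a set)"
  note wf = Well_order_props(1)[OF wo]
  note dir = omega_pow_iter_directed[OF wo shrinking_derived_set ne]
  have single: "\<exists>b\<in>underS r x. \<exists>m. S C \<inter> (?J b ^^ m) C = {}" if CC: "C \<in> \<C>" for C
  proof (rule ccontr)
    assume contr: "\<not> ?thesis"
    have "S C \<inter> (\<Inter>p\<in>underS r x \<times> UNIV. (?J (fst p) ^^ snd p) C) \<noteq> {}"
    proof (rule compact_imp_fip_image)
      show "compact (S C)" using K S[OF CC] by (metis compact_Int_closed inf_top_left)
      show "closed ((?J (fst p) ^^ snd p) C)" for p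
        using shrinking_funpow[OF shrinking_omega_pow_iter[OF wf shrinking_derived_set] C[OF CC]] by blast
      fix I assume I: "finite I" "I \<subseteq> underS r x \<times> (UNIV :: nat set)"
      obtain b m where "b \<in> underS r x" "\<forall>(b', m')\<in>I. \<forall>X. closed X \<longrightarrow> (?J b ^^ m) X \<subseteq> (?J b' ^^ m') X"
        using dir[OF I] by blast
      then have "S C \<inter> (?J b ^^ m) C \<subseteq> S C \<inter> (\<Inter>p\<in>I. (?J (fst p) ^^ snd p) C)"
        and "S C \<inter> (?J b ^^ m) C \<noteq> {}"
        using C[OF CC] contr by fastforce+
      then show "S C \<inter> (\<Inter>p\<in>I. (?J (fst p) ^^ snd p) C) \<noteq> {}" by blast
    qed
    moreover have "?J x C = (\<Inter>p\<in>underS r x \<times> UNIV. (?J (fst p) ^^ snd p) C)"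
      using ne by (subst omega_pow_iter_unfold[OF wf]) auto
    ultimately show False using disj[OF CC] by simp
  qed
  then have "\<forall>C\<in>\<C>. \<exists>p. fst p \<in> underS r x \<and> S C \<inter> (?J (fst p) ^^ snd p) C = {}"
    by (metis fst_conv snd_conv)
  then obtain p where p: "\<forall>C\<in>\<C>. fst (p C) \<in> underS r x \<and> S C \<inter> (?J (fst (p C)) ^^ snd (p C)) C = {}"
    by (rule bchoice[THEN exE]) blast
  have "finite (p ` \<C>)" "p ` \<C> \<subseteq> underS r x \<times> UNIV"
    using fin p by (simp_all add: image_subset_iff mem_Times_iff)
  from dir[OF this] have "\<exists>b'\<in>underS r x. \<exists>m'. \<forall>C\<in>\<C>. \<forall>X. closed X \<longrightarrow>
      (?J b' ^^ m') X \<subseteq> (?J (fst (p C)) ^^ snd (p C)) X"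
    by (simp add: case_prod_beta)
  then obtain b' m' where b': "b' \<in> underS r x"
      "\<forall>C\<in>\<C>. \<forall>X. closed X \<longrightarrow> (?J b' ^^ m') X \<subseteq> (?J (fst (p C)) ^^ snd (p C)) X"
    by (elim bexE exE)
  have "S C \<inter> (?J b' ^^ m') C = {}" if "C \<in> \<C>" for C
  proof -
    have "(?J b' ^^ m') C \<subseteq> (?J (fst (p C)) ^^ snd (p C)) C" using b'(2) that C[OF that] by simp
    moreover have "S C \<inter> (?J (fst (p C)) ^^ snd (p C)) C = {}" using p that by simp
    ultimately show ?thesis by (metis Int_mono order_refl subset_empty)
  qed
  then show ?thesis using b'(1) by (intro bexI[of _ b'] exI[of _ m']) auto
qed

section \<open>Induction over blocks\<close>

lemma sum_list_concat_map:
  fixes G :: "'b \<Rightarrow> real"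
  shows "(\<Sum>D\<leftarrow>concat (map h Cs). G D) = (\<Sum>C\<leftarrow>Cs. \<Sum>D\<leftarrow>h C. G D)"
  by (induction Cs) simp_all

lemma sum_list_telescope:
  fixes a :: "nat \<Rightarrow> real"
  shows "(\<Sum>j\<leftarrow>[0..<m]. a (Suc j) - a j) = a m - a 0"
  by (induction m) simp_all

text \<open>This is the induction of the upper bound. As \<open>J x C \<subseteq> C\<close>, the
  difference bounded by \<open>e\<close> is the mass outside the blocks \<open>C - J x C\<close>,
  and the counting hypothesis makes these blocks disjoint. The mass bound is required only on the
  slice \<open>t < \<psi> y\<close>, which is what lets the induction hypothesis be applied inside a
  slice.\<close>

lemma mass_block_drop:
  fixes Cs :: "'a::t2_space set list" and L :: "(('a \<Rightarrow>\<^sub>C real) \<Rightarrow>\<^sub>L real) set"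
  assumes K: "compact (UNIV :: 'a set)" and wo: "Well_order r" and \<epsilon>: "0 < \<epsilon>"
  defines "J \<equiv> omega_pow_iter r (derived_set :: 'a set \<Rightarrow> 'a set)"
    and "W \<equiv> omega_pow_iter r (dz_omega \<epsilon> :: (('a \<Rightarrow>\<^sub>C real) \<Rightarrow>\<^sub>L real) set \<Rightarrow> _)"
  shows "(\<And>C. C \<in> set Cs \<Longrightarrow> closed C) \<Longrightarrow>
    (\<And>z. (\<Sum>C\<leftarrow>Cs. of_bool (z \<in> C) - of_bool (z \<in> J x C)) \<le> (1::real)) \<Longrightarrow>
    e < \<epsilon> / 8 \<Longrightarrow> t < t' \<Longrightarrow> L \<subseteq> dual_ball \<Longrightarrow>
    (\<And>\<psi>. \<psi> \<in> L \<Longrightarrow> t < blinfun_apply \<psi> y \<Longrightarrow>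
      mass \<psi> UNIV - (\<Sum>C\<leftarrow>Cs. mass \<psi> (- J x C) - mass \<psi> (- C)) \<le> e) \<Longrightarrow>
    \<exists>k. \<forall>\<psi>\<in>(W x ^^ k) L. \<psi> y \<le> t'"
  using Well_order_props(1)[OF wo]
proof (induction x arbitrary: Cs e t t' L y rule: wf_induct_rule)
  case (less x)
  note closed = less.prems(1) and count = less.prems(2) and e = less.prems(3)
    and t = less.prems(4) and L = less.prems(5) and mass = less.prems(6)
  note wf = Well_order_props(1)[OF wo]
  have dec: "W b S \<subseteq> S" for b S
    using shrinking_omega_pow_iter[OF wf shrinking_dz_omega] unfolding W_def shrinking_def by blast
  define n where "n = real (length Cs)"
  \<comment> \<open>Each mass is at most 1 on the ball, so potential values above
    \<open>M * t'\<close> occur only where \<open>\<psi> y > t\<close>.\<close>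
  define M where "M = (n + 1) / (t' - t)"
  \<comment> \<open>Half of the slack is spent, so that \<open>e + \<delta>\<close> is still an
    admissible error.\<close>
  define \<delta> where "\<delta> = (\<epsilon> / 8 - e) / 2"
  define \<Phi> where "\<Phi> \<psi> = M * \<psi> y + (\<Sum>C\<leftarrow>Cs. mass \<psi> (- J x C))" for \<psi> :: "('a \<Rightarrow>\<^sub>C real) \<Rightarrow>\<^sub>L real"
  have n: "0 \<le> n" by (simp add: n_def)
  have M: "0 < M" "M * t' = M * t + n + 1"
    using t n by (auto simp: M_def field_simps)
  have \<delta>: "0 < \<delta>" "e + \<delta> < \<epsilon> / 8" using e by (auto simp: \<delta>_def field_simps)
  have H: "(\<Sum>C\<leftarrow>Cs. mass \<psi> (- J x C)) \<le> n" if "\<psi> \<in> L" for \<psi>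
  proof -
    have "mass \<psi> U \<le> 1" for U using mass_le_norm[of \<psi> U] L that by (auto simp: dual_ball_def)
    then have "(\<Sum>C\<leftarrow>Cs. mass \<psi> (- J x C)) \<le> (\<Sum>C\<leftarrow>Cs. 1)" by (intro sum_list_mono)
    then show ?thesis by (simp add: n_def sum_list_triv)
  qed
  have "\<exists>k. \<forall>\<psi>\<in>(W x ^^ k) L. \<Phi> \<psi> \<le> M * t'"
  proof (rule funpow_potential_drop[OF dec \<delta>(1)])
    fix \<psi> assume \<psi>: "\<psi> \<in> L"
    have "\<bar>\<psi> y\<bar> \<le> 1 * norm y"
      using norm_blinfun[of \<psi> y] mult_right_mono[of "norm \<psi>" 1 "norm y"] L \<psi> by (auto simp: dual_ball_def)
    then have "M * \<psi> y \<le> M * norm y" using M(1) by (intro mult_left_mono) auto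
    then show "\<Phi> \<psi> \<le> M * norm y + n" using H[OF \<psi>] by (simp add: \<Phi>_def)
  next
    fix L' c \<phi>
    assume L': "L' \<subseteq> L" and c: "\<And>\<psi>. \<psi> \<in> L' \<Longrightarrow> \<Phi> \<psi> \<le> c" and \<phi>: "\<phi> \<in> W x L'"
    define c' where "c' = max (c - \<delta>) (M * t')"
    show "\<Phi> \<phi> \<le> max (c - \<delta>) (M * t')"
    proof (rule ccontr)
      assume "\<not> \<Phi> \<phi> \<le> max (c - \<delta>) (M * t')"
      then have big: "c' < \<Phi> \<phi>" by (simp add: c'_def not_le)
      \<comment> \<open>Losing \<open>\<tau>\<close> for each of the \<open>n\<close> list entries
        keeps \<open>\<phi> y'\<close> above \<open>c'\<close>.\<close>
      define \<tau> where "\<tau> = (\<Phi> \<phi> - c') / (n + 1)"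
      have \<tau>: "0 < \<tau>" "n * \<tau> < \<Phi> \<phi> - c'"
        using big n by (auto simp: \<tau>_def field_simps)
      have "\<exists>g. norm g \<le> 1 \<and> supp g \<subseteq> - J x C \<and> mass \<phi> (- J x C) - \<tau> \<le> \<phi> g" for C
        using mass_approx[of "mass \<phi> (- J x C) - \<tau>" \<phi> "- J x C"] \<tau>(1) by (metis diff_less_eq less_add_same_cancel1 less_imp_le)
      then obtain g where g: "\<And>C. norm (g C) \<le> 1" "\<And>C. supp (g C) \<subseteq> - J x C"
          "\<And>C. mass \<phi> (- J x C) - \<tau> \<le> \<phi> (g C)" by metis
      \<comment> \<open>A linear minorant of the potential:
        \<open>\<psi> y' \<le> \<Phi> \<psi>\<close> for every \<open>\<psi>\<close>, nearly with
        equality at \<open>\<phi>\<close>.\<close>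
      define y' where "y' = M *\<^sub>R y + (\<Sum>C\<leftarrow>Cs. g C)"
      have y': "\<psi> y' = M * \<psi> y + (\<Sum>C\<leftarrow>Cs. \<psi> (g C))" for \<psi> :: "('a \<Rightarrow>\<^sub>C real) \<Rightarrow>\<^sub>L real"
      proof -
        have "\<psi> (\<Sum>C\<leftarrow>Cs. g C) = (\<Sum>C\<leftarrow>Cs. \<psi> (g C))"
          by (induction Cs) (simp_all add: blinfun.add_right)
        then show ?thesis by (simp add: y'_def blinfun.add_right blinfun.scaleR_right)
      qed
      have "(\<Sum>C\<leftarrow>Cs. mass \<phi> (- J x C) - \<tau>) \<le> (\<Sum>C\<leftarrow>Cs. \<phi> (g C))"
        using g(3) by (intro sum_list_mono)
      then have \<phi>y': "c' < \<phi> y'"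
        using \<tau>(2) by (simp add: y' \<Phi>_def sum_list_subtractf sum_list_triv n_def)
      \<comment> \<open>On this slice the \<open>g C\<close> capture the masses up to a total of
        \<open>\<delta>\<close>, because \<open>\<Phi> \<psi> \<le> c\<close> and
        \<open>c' \<ge> c - \<delta>\<close>.\<close>
      have near: "mass \<psi> UNIV - (\<Sum>C\<leftarrow>Cs. \<psi> (g C) - mass \<psi> (- C)) \<le> e + \<delta>"
        if \<psi>: "\<psi> \<in> L'" "c' < \<psi> y'" for \<psi>
      proof -
        have "(\<Sum>C\<leftarrow>Cs. \<psi> (g C)) \<le> (\<Sum>C\<leftarrow>Cs. mass \<psi> (- J x C))"
          using g(1,2) by (intro sum_list_mono mass_upper)
        then have "M * t' < M * \<psi> y + n"
          using \<psi> H[of \<psi>] L' unfolding y' c'_def by fastforce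
        then have "M * t < M * \<psi> y" using M(2) by linarith
        then have "mass \<psi> UNIV - (\<Sum>C\<leftarrow>Cs. mass \<psi> (- J x C) - mass \<psi> (- C)) \<le> e"
          using M(1) \<psi>(1) L' by (intro mass) auto
        moreover have "(\<Sum>C\<leftarrow>Cs. mass \<psi> (- J x C)) - (\<Sum>C\<leftarrow>Cs. \<psi> (g C)) \<le> \<delta>"
          using c[OF \<psi>(1)] \<psi>(2) by (simp add: y' \<Phi>_def c'_def)
        ultimately show ?thesis by (simp add: sum_list_subtractf)
      qed
      \<comment> \<open>The drop lemmas need a gap between two levels; \<open>t''\<close> leaves one
        while staying below \<open>\<phi> y'\<close>.\<close>
      obtain t'' where t'': "c' < t''" "t'' < \<phi> y'" using \<phi>y' dense by blast
      have L'ball: "L' \<subseteq> dual_ball" using L L' by blast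
      show False
      proof (cases "underS r x = {}")
        case True
        then have Jx: "J x = derived_set" and Wx: "W x = dz_omega \<epsilon>"
          unfolding J_def W_def by (auto simp: omega_pow_iter_unfold[OF wf])
        define F where "F = (\<Union>C\<in>set Cs. supp (g C) \<inter> C)"
        note fin = mass_compl_finite_le[OF K closed count[unfolded Jx] g(1) g(2)[unfolded Jx], folded F_def]
        have "mass \<psi> (- F) \<le> e + \<delta>" if "\<psi> \<in> L'" "c' < \<psi> y'" for \<psi>
          using fin(2)[of \<psi>] near[OF that] by linarith
        then obtain k where "\<And>\<psi>. \<psi> \<in> (dz_deriv \<epsilon> ^^ k) L' \<Longrightarrow> \<psi> y' \<le> t''"
          using finite_mass_drop[OF K fin(1) \<epsilon> \<delta>(2) t''(1) L'ball] by blast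
        then show False using \<phi> t''(2) unfolding Wx by fastforce
      next
        case False
        have "\<exists>b\<in>underS r x. \<exists>m. \<forall>C\<in>set Cs. supp (g C) \<inter> (J b ^^ m) C = {}"
          unfolding J_def
          using closed g(2) by (intro omega_pow_iter_derived_compact[OF K wo False]) (auto simp: J_def)
        then obtain b m where b: "b \<in> underS r x" and m: "\<And>C. C \<in> set Cs \<Longrightarrow> supp (g C) \<inter> (J b ^^ m) C = {}"
          by blast
        \<comment> \<open>Each \<open>C\<close> is replaced by its stages 0 to \<open>m - 1\<close>
          at exponent \<open>b\<close>, whose blocks together form \<open>C\<close> minus stage
          \<open>m\<close>. Stage \<open>m\<close> is disjoint from the support of
          \<open>g C\<close>.\<close>
        define Ds where "Ds = concat (map (\<lambda>C. map (\<lambda>j. (J b ^^ j) C) [0..<m]) Cs)"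
        have telescope: "(\<Sum>D\<leftarrow>Ds. a (J b D) - a D) = (\<Sum>C\<leftarrow>Cs. a ((J b ^^ m) C) - a C)" for a :: "'a set \<Rightarrow> real"
          unfolding Ds_def sum_list_concat_map
          using sum_list_telescope[of "\<lambda>j. a ((J b ^^ j) _)" m] by (simp add: comp_def)
        have "\<exists>k. \<forall>\<psi>\<in>(W b ^^ k) L'. \<psi> y' \<le> t''"
        proof (rule less.IH[where Cs = Ds and e = "e + \<delta>" and t = c'])
          show "(b, x) \<in> r - Id" using b by (auto simp: underS_def)
          show "closed D" if "D \<in> set Ds" for D
            using that shrinking_funpow[OF shrinking_omega_pow_iter[OF wf shrinking_derived_set] closed]
            by (auto simp: Ds_def J_def)
          show "(\<Sum>D\<leftarrow>Ds. of_bool (z \<in> D) - of_bool (z \<in> J b D)) \<le> (1::real)" for z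
          proof -
            have "(\<Sum>D\<leftarrow>Ds. of_bool (z \<in> D) - of_bool (z \<in> J b D)) =
                (\<Sum>C\<leftarrow>Cs. of_bool (z \<in> C) - of_bool (z \<in> (J b ^^ m) C) :: real)"
              using telescope[of "\<lambda>D. - of_bool (z \<in> D)"] by simp
            \<comment> \<open>Stage \<open>m\<close> contains \<open>J x C\<close>, so the new
              blocks cover no more than the old ones.\<close>
            also have "\<dots> \<le> (\<Sum>C\<leftarrow>Cs. of_bool (z \<in> C) - of_bool (z \<in> J x C))"
              using omega_pow_iter_subset[OF wf b, of derived_set _ m] unfolding J_def
              by (intro sum_list_mono) (auto simp: of_bool_def)
            finally show ?thesis using count[of z] by linarith
          qed
          show "mass \<psi> UNIV - (\<Sum>D\<leftarrow>Ds. mass \<psi> (- J b D) - mass \<psi> (- D)) \<le> e + \<delta>"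
            if "\<psi> \<in> L'" "c' < \<psi> y'" for \<psi>
          proof -
            have "(\<Sum>C\<leftarrow>Cs. \<psi> (g C) - mass \<psi> (- C)) \<le> (\<Sum>C\<leftarrow>Cs. mass \<psi> (- (J b ^^ m) C) - mass \<psi> (- C))"
              using g(1) m by (intro sum_list_mono diff_right_mono mass_upper) auto
            then show ?thesis
              using telescope[of "\<lambda>D. mass \<psi> (- D)"] near[OF that] by simp
          qed
        qed (use \<delta> t'' L'ball in auto)
        then obtain k where "\<And>\<psi>. \<psi> \<in> (W b ^^ k) L' \<Longrightarrow> \<psi> y' \<le> t''" by blast
        then show False
          using \<phi> t''(2) omega_pow_iter_subset[OF wf b, of "dz_omega \<epsilon>" L' k] unfolding W_def by fastforce
      qed
    qed
  qed
  then obtain k where k: "\<And>\<psi>. \<psi> \<in> (W x ^^ k) L \<Longrightarrow> \<Phi> \<psi> \<le> M * t'" by blast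
  have "M * \<psi> y \<le> M * t'" if "\<psi> \<in> (W x ^^ k) L" for \<psi>
  proof -
    have "0 \<le> (\<Sum>C\<leftarrow>Cs. mass \<psi> (- J x C))" by (rule sum_list_nonneg) (auto simp: mass_nonneg)
    then show ?thesis using k[OF that] by (simp add: \<Phi>_def)
  qed
  then show ?case using M(1) by auto
qed

text \<open>The first \<open>m\<close> stages of the space give blocks that fill the whole space, so
  by telescoping no mass is left outside them.\<close>

lemma omega_pow_iter_dual_ball_empty:
  assumes K: "compact (UNIV :: 'a::t2_space set)" and wo: "Well_order r" and \<epsilon>: "0 < \<epsilon>"
    and empty: "(omega_pow_iter r derived_set x ^^ m) (UNIV :: 'a set) = {}"
  shows "\<exists>k. (omega_pow_iter r (dz_omega \<epsilon>) x ^^ k) (dual_ball :: (('a \<Rightarrow>\<^sub>C real) \<Rightarrow>\<^sub>L real) set) = {}"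
proof -
  let ?J = "omega_pow_iter r (derived_set :: 'a set \<Rightarrow> 'a set) x"
  let ?B = "dual_ball :: (('a \<Rightarrow>\<^sub>C real) \<Rightarrow>\<^sub>L real) set"
  define Cs where "Cs = map (\<lambda>j. (?J ^^ j) UNIV) [0..<m]"
  have telescope: "(\<Sum>C\<leftarrow>Cs. a (?J C) - a C) = a {} - a UNIV" for a :: "'a set \<Rightarrow> real"
    using sum_list_telescope[of "\<lambda>j. a ((?J ^^ j) UNIV)" m] by (simp add: Cs_def comp_def empty)
  \<comment> \<open>With \<open>y = 0\<close> every functional takes the value 0 > -1, so the slice
    is the whole ball, and a bound of \<open>- 1 / 2\<close> can only hold on the empty set.\<close>
  have "\<exists>k. \<forall>\<psi>\<in>(omega_pow_iter r (dz_omega \<epsilon>) x ^^ k) ?B. \<psi> 0 \<le> - 1 / 2"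
  proof (rule mass_block_drop[OF K wo \<epsilon>, where Cs = Cs and e = 0 and t = "-1"])
    show "closed C" if "C \<in> set Cs" for C
      using that shrinking_funpow[OF shrinking_omega_pow_iter[OF Well_order_props(1)[OF wo] shrinking_derived_set] closed_UNIV]
      by (auto simp: Cs_def)
    show "(\<Sum>C\<leftarrow>Cs. of_bool (z \<in> C) - of_bool (z \<in> ?J C)) \<le> (1::real)" for z
      using telescope[of "\<lambda>D. - of_bool (z \<in> D)"] by simp
    show "mass \<psi> UNIV - (\<Sum>C\<leftarrow>Cs. mass \<psi> (- ?J C) - mass \<psi> (- C)) \<le> 0" for \<psi>
      using telescope[of "\<lambda>D. mass \<psi> (- D)"] by simp
  qed (use \<epsilon> in auto)
  then show ?thesis by auto
qed

section \<open>Combination of the two bounds\<close>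

theorem mainTheorem12:
  fixes \<alpha> :: "nat rel"
  assumes "Well_order \<alpha>"
    and "compact (UNIV :: 'a::t2_space set)"
    and "titer (omega_exp \<alpha>) derived_set (UNIV :: 'a set) \<noteq> {}"
    and "titer (omega_exp (osucc \<alpha>)) derived_set (UNIV :: 'a set) = {}"
  shows "Dz_eq TYPE('a \<Rightarrow>\<^sub>C real) (omega_exp (osucc (oneplus \<alpha>)))"
proof -
  note wo = assms(1) and K = assms(2)
  let ?s = "osucc \<alpha>" and ?r = "osucc (oneplus \<alpha>)"
  let ?B = "dual_ball :: (('a \<Rightarrow>\<^sub>C real) \<Rightarrow>\<^sub>L real) set"
  note wos = Well_order_osucc[OF wo]
  note woss = Well_order_osucc[OF wos]
  note wor = Well_order_osucc[OF Well_order_oneplus[OF wo]]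
  have dz: "shrinking (\<lambda>_. True) (dz_deriv \<epsilon> :: (('a \<Rightarrow>\<^sub>C real) \<Rightarrow>\<^sub>L real) set \<Rightarrow> _)" for \<epsilon>
    using dz_deriv_subset by (auto simp: shrinking_def)
  have shift: "omega_pow_iter ?r (dz_deriv \<epsilon>) (shift_exp x) =
      omega_pow_iter ?s (dz_omega \<epsilon> :: (('a \<Rightarrow>\<^sub>C real) \<Rightarrow>\<^sub>L real) set \<Rightarrow> _) x" if "x \<in> Field ?s" for x \<epsilon>
    using omega_pow_iter_shift[OF wo dz that] by auto
  show ?thesis
    unfolding Dz_eq_def
  proof (intro conjI allI impI)
    fix \<epsilon> :: real assume \<epsilon>: "0 < \<epsilon>"
    have "omega_pow_iter (osucc ?s) derived_set None (UNIV :: 'a set) = {}"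
      using assms(4) by (simp add: titer_omega_exp_eq_pow_iter[OF wos shrinking_derived_set closed_UNIV])
    \<comment> \<open>Compactness: if the derived set of order omega^(alpha+1) is empty, so is one
      of order omega^x m with \<open>x\<close> at most alpha.\<close>
    then have "\<exists>b\<in>underS (osucc ?s) None. \<exists>m. \<forall>C\<in>{UNIV :: 'a set}.
        UNIV \<inter> (omega_pow_iter (osucc ?s) derived_set b ^^ m) C = {}"
      by (intro omega_pow_iter_derived_compact[OF K woss]) (auto simp: underS_osucc Field_osucc)
    then obtain x m where x: "x \<in> Field ?s"
        "(omega_pow_iter (osucc ?s) derived_set (Some x) ^^ m) (UNIV :: 'a set) = {}"
      by (auto simp: underS_osucc)
    have "omega_pow_iter (osucc ?s) derived_set (Some x) = omega_pow_iter ?s (derived_set :: 'a set \<Rightarrow> 'a set) x"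
      using x(1) by (intro omega_pow_iter_embed Well_order_props(1) wos woss) (auto simp: underS_osucc)
    then obtain k where "(omega_pow_iter ?s (dz_omega \<epsilon>) x ^^ k) ?B = {}"
      using x(2) omega_pow_iter_dual_ball_empty[OF K wos \<epsilon>] by metis
    then have "(omega_pow_iter ?r (dz_deriv \<epsilon>) (shift_exp x) ^^ k) ?B = {}"
      using shift[OF x(1)] by simp
    moreover have "titer (omega_exp ?r) (dz_deriv \<epsilon>) ?B =
        (\<Inter>x\<in>Field ?r. \<Inter>k. (omega_pow_iter ?r (dz_deriv \<epsilon>) x ^^ k) ?B)"
      by (rule titer_omega_exp[OF wor dz]) (simp_all add: Field_osucc)
    ultimately show "titer (omega_exp ?r) (dz_deriv \<epsilon>) ?B = {}"
      using shift_exp_Field[OF x(1)] by blast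
  next
    fix \<beta> :: "(nat option option \<Rightarrow> nat) rel"
    assume "Well_order \<beta> \<and> (\<beta>, omega_exp ?r) \<in> ordLess"
    then obtain p where p: "p \<in> Field (omega_exp ?r)"
        "\<And>f (X :: (('a \<Rightarrow>\<^sub>C real) \<Rightarrow>\<^sub>L real) set). titer \<beta> f X = titer_at (omega_exp ?r) f X p"
      using titer_ordLess by blast
    \<comment> \<open>\<open>None\<close> is the largest exponent, 1 + alpha; one more than its
      coefficient in \<open>p\<close> gives a multiple beyond \<open>p\<close>.\<close>
    define n where "n = Suc (p None)"
    have "\<not> None \<in> underS ?r x" for x
      by (cases x) (auto simp: underS_osucc)
    then have less: "p \<in> underS (omega_exp ?r) ((\<lambda>_. 0)(None := n))"
      using p(1) unfolding omega_exp_less_iff[OF wor] Field_omega_exp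
      by (auto simp: n_def Field_osucc intro!: fin_supp_upd)
    obtain z :: 'a where "z \<in> omega_pow_iter ?s derived_set None UNIV"
      using assms(3) by (auto simp: titer_omega_exp_eq_pow_iter[OF wo shrinking_derived_set closed_UNIV])
    \<comment> \<open>The choice of epsilon as \<open>1 / n\<close> lets the origin survive
      \<open>n\<close> blocks of order omega^(1+alpha), which is past the index
      \<open>p\<close>.\<close>
    then have "0 \<in> (omega_pow_iter ?s (dz_omega (1 / real n)) None ^^ n) ?B"
      by (rule zero_mem_omega_pow_iter[OF K Well_order_props(1)[OF wos]]) (simp add: n_def)
    also have "\<dots> = titer_at (omega_exp ?r) (dz_deriv (1 / real n)) ?B ((\<lambda>_. 0)(None := n))"
      using titer_at_omega_exp_multiple[OF wor dz, of None "1 / real n" ?B n] shift[of None "1 / real n"]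
      by (simp add: Field_osucc shift_exp_def)
    also have "\<dots> \<subseteq> titer_at (omega_exp ?r) (dz_deriv (1 / real n)) ?B p"
      using shrinking_titer_at[OF wf_omega_exp[OF wor] antisym_omega_exp[OF wor] trans_omega_exp[OF wor] dz] less
      by blast
    finally have "titer \<beta> (dz_deriv (1 / real n)) ?B \<noteq> {}" unfolding p(2) by blast
    then show "\<exists>\<epsilon>>0. titer \<beta> (dz_deriv \<epsilon>) ?B \<noteq> {}"
      by (intro exI[of _ "1 / real n"]) (simp add: n_def)
  qed
qed

end
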